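(* Let $\varphi$ be a parabolic automorphism of $\mathbb{D}$ with Denjoy-Wolff point $a\in\partial\mathbb{D}$. Assume that $\psi\in H^\infty(\mathbb{D})$ is not identically zero and is continuous at the point $a$. If the weighted composition operator $C_{\psi,\varphi}$ on $H^2(\mathbb{D})$ is not invertible, then the spectrum of $C_{\psi,\varphi}$ on $H^2(\mathbb{D})$ is $$\left\{\lambda\in\mathbb{C} : |\lambda|\leqslant|\psi(a)|\right\}.$$
   Context: $\mathbb{D}$ is the open unit disk in $\mathbb{C}$. $H^2(\mathbb{D})$ is the Hardy-Hilbert space of analytic functions $f$ on $\mathbb{D}$ with $\|f\|^2=\sup_{0<r<1}\int_0^{2\pi}|f(re^{i\theta})|^2\frac{d\theta}{2\pi}<\infty$. $H^\infty(\mathbb{D})$ is the space of bounded analytic functions on $\mathbb{D}$. For an automorphism $\varphi$ of $\mathbb{D}$ and $\psi\in H^\infty(\mathbb{D})$, $C_{\psi,\varphi}$ is the bounded operator $C_{\psi,\varphi}f=\psi\cdot(f\circ\varphi)$. An automorphism of $\mathbb{D}$ (extended to $\overline{\mathbb{D}}$) is parabolic if it has no fixed point in $\mathbb{D}$ and only one fixed point on $\partial\mathbb{D}$; this fixed point is its Denjoy-Wolff point, to which its iterates converge uniformly on compact subsets of $\mathbb{D}$. For $c\in\partial\mathbb{D}$, "$\psi$ is continuous at $c$" means that the limit of $\psi(z)$ as $z\to c$, $z\in\mathbb{D}$, exists; this limit is denoted $\psi(c)$. *)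

theory Defs
  imports "HOL-Complex_Analysis.Complex_Analysis"
begin

section \<open>The Hardy space \<open>H\<^sup>2\<close> of the unit disk\<close>

definition hardy_mean :: "(complex \<Rightarrow> complex) \<Rightarrow> real \<Rightarrow> real" where
  "hardy_mean f r = integral {0..2*pi} (\<lambda>\<theta>. (cmod (f (of_real r * cis \<theta>)))\<^sup>2 / (2*pi))"

text \<open>
  Functions on the disk are represented by total functions that vanish off the disk, so that
  equality in \<open>H2\<close> is HOL equality.
\<close>

definition H2 :: "(complex \<Rightarrow> complex) set" where
  "H2 = {f. f holomorphic_on ball 0 1 \<and> (\<forall>z. z \<notin> ball 0 1 \<longrightarrow> f z = 0) \<and>
            bdd_above (hardy_mean f ` {0<..<1})}"

definition H2_norm :: "(complex \<Rightarrow> complex) \<Rightarrow> real" where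
  "H2_norm f = sqrt (SUP r\<in>{0<..<1}. hardy_mean f r)"

definition Hinf :: "(complex \<Rightarrow> complex) set" where
  "Hinf = {f. f holomorphic_on ball 0 1 \<and> bounded (f ` ball 0 1)}"


section \<open>Bounded operators on \<open>H\<^sup>2\<close> and their spectrum\<close>

definition H2_bounded_operator :: "((complex \<Rightarrow> complex) \<Rightarrow> complex \<Rightarrow> complex) \<Rightarrow> bool" where
  "H2_bounded_operator T \<longleftrightarrow>
     (\<forall>f\<in>H2. T f \<in> H2) \<and>
     (\<forall>f\<in>H2. \<forall>g\<in>H2. T (\<lambda>z. f z + g z) = (\<lambda>z. T f z + T g z)) \<and>
     (\<forall>c. \<forall>f\<in>H2. T (\<lambda>z. c * f z) = (\<lambda>z. c * T f z)) \<and>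
     (\<exists>K. \<forall>f\<in>H2. H2_norm (T f) \<le> K * H2_norm f)"

definition H2_invertible :: "((complex \<Rightarrow> complex) \<Rightarrow> complex \<Rightarrow> complex) \<Rightarrow> bool" where
  "H2_invertible T \<longleftrightarrow>
     H2_bounded_operator T \<and>
     (\<exists>S. H2_bounded_operator S \<and> (\<forall>f\<in>H2. S (T f) = f \<and> T (S f) = f))"

definition H2_spectrum :: "((complex \<Rightarrow> complex) \<Rightarrow> complex \<Rightarrow> complex) \<Rightarrow> complex set" where
  "H2_spectrum T = {\<mu>. \<not> H2_invertible (\<lambda>f z. T f z - \<mu> * f z)}"

definition weighted_composition ::
    "(complex \<Rightarrow> complex) \<Rightarrow> (complex \<Rightarrow> complex) \<Rightarrow> (complex \<Rightarrow> complex) \<Rightarrow> complex \<Rightarrow> complex" where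
  "weighted_composition \<psi> \<phi> f = (\<lambda>z. if z \<in> ball 0 1 then \<psi> z * f (\<phi> z) else 0)"


section \<open>Parabolic automorphisms of the disk\<close>

definition disk_automorphism :: "(complex \<Rightarrow> complex) \<Rightarrow> bool" where
  "disk_automorphism \<phi> \<longleftrightarrow>
     \<phi> holomorphic_on ball 0 1 \<and> bij_betw \<phi> (ball 0 1) (ball 0 1)"

text \<open>
  The extension of a map of the disk to the closed disk by its boundary limits; these limits
  exist at every boundary point if the map is an automorphism. The values that the HOL function
  \<open>\<phi>\<close> happens to have off the open disk play no role.
\<close>

definition disk_extension :: "(complex \<Rightarrow> complex) \<Rightarrow> complex \<Rightarrow> complex" where
  "disk_extension \<phi> w = (if w \<in> ball 0 1 then \<phi> w else Lim (at w within ball 0 1) \<phi>)"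

definition parabolic_automorphism :: "(complex \<Rightarrow> complex) \<Rightarrow> bool" where
  "parabolic_automorphism \<phi> \<longleftrightarrow>
     disk_automorphism \<phi> \<and>
     (\<forall>z\<in>ball 0 1. \<phi> z \<noteq> z) \<and>
     (\<exists>!w. w \<in> sphere 0 1 \<and> disk_extension \<phi> w = w)"

definition denjoy_wolff_point :: "(complex \<Rightarrow> complex) \<Rightarrow> complex \<Rightarrow> bool" where
  "denjoy_wolff_point \<phi> a \<longleftrightarrow>
     a \<in> cball 0 1 \<and> disk_extension \<phi> a = a \<and>
     (\<forall>K. compact K \<and> K \<subseteq> ball 0 1 \<longrightarrow>
        uniform_limit K (\<lambda>n. \<phi> ^^ n) (\<lambda>_. a) sequentially)"

end

theory Submission
  imports Defs
begin

text \<open>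
  In the coordinate \<open>w = (a + z) / (a - z)\<close> the disk is the right half-plane, the Denjoy--Wolff point is
  infinity and the automorphism is the translation by \<open>\<i> \<tau>\<close> for a real \<open>\<tau> \<noteq> 0\<close>
  (\<open>parabolic_automorphism_is_flow\<close>). The weight is close to \<open>\<psi>a\<close> when \<open>\<bar>w\<bar>\<close> is large. Both inclusions
  rest on the fact that an orbit of the translation spends only a bounded number of steps in a bounded
  region.

  Outside the disk: the \<open>n\<close>-th power of the operator has a weight which is a product of \<open>n\<close> values of \<open>\<psi>\<close>
  along an orbit, and all but boundedly many of them are close to \<open>\<psi>a\<close>. By subordination
  (\<open>H2_weighted_composition\<close>) composition with the translation by \<open>\<i> n \<tau>\<close> has norm \<open>O(n)\<close>. The Neumann
  series of the resolvent therefore converges for \<open>\<bar>\<mu>\<bar> > \<bar>\<psi>a\<bar>\<close> (\<open>resolvent_invertible\<close>).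

  Inside the disk: the operator is invertible if \<open>\<bar>\<psi>\<bar>\<close> is bounded below, so by assumption \<open>\<psi>\<close> takes values
  arbitrarily close to 0. The adjoint maps the reproducing kernel at \<open>z\<close> to a multiple, by the conjugate
  of \<open>\<psi> z\<close>, of the kernel at \<open>\<phi> z\<close>: it is a weighted shift along the kernels of an orbit, which is almost
  cut off at a point where \<open>\<psi>\<close> is almost 0. Summing kernels along the backward orbit of such a point, with
  suitable coefficients, gives an approximate eigenvector for each \<open>\<nu>\<close> with \<open>\<bar>\<nu>\<bar> < \<bar>\<psi>a\<bar>\<close>
  (\<open>adjoint_functional_properties\<close>). The coefficients decay geometrically, uniformly in the point, provided
  that \<open>\<psi>\<close> stays away from 0 on the rest of the backward orbit; \<open>backward_orbit_selection\<close> provides such points.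
  The functional does not degenerate, because it is at least 1/2 on a function that peaks at the
  point (\<open>H2_peak_function\<close>). Since \<open>\<nu>\<close> may be any number near \<open>\<mu>\<close>, the circle \<open>\<bar>\<mu>\<bar> = \<bar>\<psi>a\<bar>\<close> is covered too
  (\<open>approximate_adjoint_eigenvector\<close>).
\<close>

section \<open>Poisson integrals and integral means\<close>

definition poisson_kernel :: "complex \<Rightarrow> complex \<Rightarrow> real" where
  "poisson_kernel p \<zeta> = (1 - (cmod p)\<^sup>2) / (cmod (\<zeta> - p))\<^sup>2"

text \<open>
  Apply Cauchy's formula at \<open>p\<close> to \<open>G z (1 - \<bar>p\<bar>\<^sup>2) / (1 - cnj p z)\<close>, which agrees with \<open>G\<close> at
  \<open>p\<close>: on the unit circle \<open>1 - cnj p \<zeta> = \<zeta> cnj (\<zeta> - p)\<close>, and the Cauchy kernel turns into the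
  Poisson kernel.
\<close>
lemma poisson_integral:
  fixes G :: "complex \<Rightarrow> complex"
  assumes cont: "continuous_on (cball 0 1) G" and hol: "G holomorphic_on ball 0 1"
    and p: "cmod p < 1"
  shows "((\<lambda>\<theta>. G (cis \<theta>) * of_real (poisson_kernel p (cis \<theta>))) has_integral (2 * pi * G p)) {0..2*pi}"
proof -
  have nz: "1 - cnj p * z \<noteq> 0" if "cmod z \<le> 1" for z
  proof -
    have "cmod (cnj p * z) < 1"
      using p that by (metis complex_mod_cnj mult_left_le norm_ge_zero norm_mult order_le_less_trans)
    then show ?thesis by (metis less_irrefl norm_one right_minus_eq)
  qed
  define H where "H z = G z * (1 - of_real ((cmod p)\<^sup>2)) / (1 - cnj p * z)" for z
  have "((\<lambda>u. H u / (u - p)) has_contour_integral (2 * of_real pi * \<i> * H p)) (circlepath 0 1)"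
  proof (rule Cauchy_integral_circlepath)
    show "continuous_on (cball 0 1) H"
      unfolding H_def using nz by (intro continuous_intros cont) auto
    show "H holomorphic_on ball 0 1"
      unfolding H_def using nz by (intro holomorphic_intros hol) auto
    show "norm (p - 0) < 1" using p by simp
  qed
  then have "((\<lambda>t. H (cis t) / (cis t - p) * \<i> * cis t) has_integral (2 * of_real pi * \<i> * H p)) {0..2*pi}"
    unfolding circlepath_def
    by (subst (asm) has_contour_integral_part_circlepath_iff) auto
  from has_integral_mult_right[OF this, of "-\<i>"]
  have 1: "((\<lambda>t. H (cis t) * cis t / (cis t - p)) has_integral (2 * of_real pi * H p)) {0..2*pi}"
    by (simp add: mult_ac)
  have Hp: "H p = G p"
    using nz[of p] p by (simp add: H_def complex_norm_square mult.commute del: of_real_power)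
  have 2: "H (cis t) * cis t / (cis t - p) = G (cis t) * of_real (poisson_kernel p (cis t))" for t
  proof -
    define \<zeta> where "\<zeta> = cis t"
    have u: "\<zeta> * cnj \<zeta> = 1" by (simp add: \<zeta>_def complex_norm_square[symmetric] del: cis_cnj)
    define D where "D = cnj (\<zeta> - p)"
    have "1 - cnj p * \<zeta> = \<zeta> * D" using u by (simp add: D_def algebra_simps)
    moreover have "\<zeta> \<noteq> 0" using p by (auto simp: \<zeta>_def)
    ultimately have "H \<zeta> * \<zeta> / (\<zeta> - p) =
        G \<zeta> * (1 - of_real ((cmod p)\<^sup>2)) / ((\<zeta> - p) * cnj (\<zeta> - p))"
      unfolding D_def[symmetric] by (simp add: H_def)
    also have "\<dots> = G \<zeta> * of_real (poisson_kernel p \<zeta>)"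
      unfolding poisson_kernel_def complex_norm_square[symmetric] by simp
    finally show ?thesis unfolding \<zeta>_def .
  qed
  show ?thesis using 1 unfolding 2 Hp by simp
qed

lemma poisson_nonneg: "cmod p < 1 \<Longrightarrow> 0 \<le> poisson_kernel p \<zeta>"
  by (auto simp: poisson_kernel_def power_le_one)

lemma poisson_le:
  assumes "cmod p < 1" "cmod \<zeta> = 1"
  shows "poisson_kernel p \<zeta> \<le> (1 + cmod p) / (1 - cmod p)"
proof -
  have "1 - cmod p \<le> cmod (\<zeta> - p)" using assms norm_triangle_ineq2[of \<zeta> p] by simp
  then have "(1 - cmod p)\<^sup>2 \<le> (cmod (\<zeta> - p))\<^sup>2" using assms by (intro power_mono) auto
  then have "poisson_kernel p \<zeta> \<le> (1 - (cmod p)\<^sup>2) / (1 - cmod p)\<^sup>2"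
    unfolding poisson_kernel_def using assms by (intro divide_left_mono) (auto simp: power_le_one zero_less_mult_iff)
  also have "\<dots> = (1 + cmod p) / (1 - cmod p)"
    using assms by (simp add: power2_eq_square divide_simps) (simp add: algebra_simps)
  finally show ?thesis .
qed

lemma circle_integrable:
  fixes g :: "complex \<Rightarrow> complex"
  assumes "continuous_on (sphere 0 r) g" "0 \<le> r"
  shows "(\<lambda>\<theta>. (cmod (g (of_real r * cis \<theta>)))\<^sup>2 / (2*pi)) integrable_on {0..2*pi}"
proof -
  have "continuous_on {0..2*pi} (\<lambda>\<theta>. g (of_real r * cis \<theta>))"
    by (rule continuous_on_compose2[OF assms(1)])
       (use assms(2) in \<open>auto intro!: continuous_intros simp: norm_mult\<close>)
  then show ?thesis
    by (intro integrable_continuous_real continuous_intros) auto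
qed

lemma hardy_mean_nonneg: "0 \<le> hardy_mean f r"
  unfolding hardy_mean_def
  by (cases "(\<lambda>\<theta>. (cmod (f (of_real r * cis \<theta>)))\<^sup>2 / (2*pi)) integrable_on {0..2*pi}")
     (auto intro: integral_nonneg simp: not_integrable_integral simp del: integral_divide)

lemma hardy_mean_mono:
  fixes f g :: "complex \<Rightarrow> complex"
  assumes "continuous_on (sphere 0 r) f" "continuous_on (sphere 0 r) g" "0 \<le> r"
    and le: "\<And>z. cmod z = r \<Longrightarrow> cmod (f z) \<le> C * cmod (g z)"
  shows "hardy_mean f r \<le> C\<^sup>2 * hardy_mean g r"
  unfolding hardy_mean_def integral_mult_right[symmetric]
proof (rule integral_le)
  show "(\<lambda>\<theta>. (cmod (f (of_real r * cis \<theta>)))\<^sup>2 / (2*pi)) integrable_on {0..2*pi}"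
    using assms by (intro circle_integrable)
  show "(\<lambda>\<theta>. C\<^sup>2 * ((cmod (g (of_real r * cis \<theta>)))\<^sup>2 / (2*pi))) integrable_on {0..2*pi}"
    using assms by (intro integrable_on_mult_right circle_integrable)
  fix \<theta> :: real
  have "(cmod (f (of_real r * cis \<theta>)))\<^sup>2 \<le> (C * cmod (g (of_real r * cis \<theta>)))\<^sup>2"
    using assms(3) by (intro power_mono le) (auto simp: norm_mult)
  then show "(cmod (f (of_real r * cis \<theta>)))\<^sup>2 / (2*pi)
      \<le> C\<^sup>2 * ((cmod (g (of_real r * cis \<theta>)))\<^sup>2 / (2*pi))"
    by (simp add: power_mult_distrib divide_right_mono)
qed

lemma hardy_mean_add:
  fixes f g :: "complex \<Rightarrow> complex"
  assumes "continuous_on (sphere 0 r) f" "continuous_on (sphere 0 r) g" "0 \<le> r"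
  shows "hardy_mean (\<lambda>z. f z + g z) r \<le> 2 * hardy_mean f r + 2 * hardy_mean g r"
  unfolding hardy_mean_def integral_mult_right[symmetric]
proof (subst integral_add[symmetric])
  let ?F = "\<lambda>f \<theta>. (cmod (f (of_real r * cis \<theta>)))\<^sup>2 / (2*pi)"
  show i: "(\<lambda>\<theta>. 2 * ?F f \<theta>) integrable_on {0..2*pi}" "(\<lambda>\<theta>. 2 * ?F g \<theta>) integrable_on {0..2*pi}"
    using assms by (intro integrable_on_mult_right circle_integrable; simp)+
  show "integral {0..2*pi} (?F (\<lambda>z. f z + g z)) \<le> integral {0..2*pi} (\<lambda>\<theta>. 2 * ?F f \<theta> + 2 * ?F g \<theta>)"
  proof (rule integral_le)
    show "?F (\<lambda>z. f z + g z) integrable_on {0..2*pi}"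
      using assms by (intro circle_integrable continuous_intros)
    show "(\<lambda>\<theta>. 2 * ?F f \<theta> + 2 * ?F g \<theta>) integrable_on {0..2*pi}"
      by (intro integrable_add i)
    have sq: "(cmod (u + v))\<^sup>2 \<le> 2 * (cmod u)\<^sup>2 + 2 * (cmod v)\<^sup>2" for u v
    proof -
      have "(cmod (u + v))\<^sup>2 \<le> (cmod u + cmod v)\<^sup>2" by (intro power_mono norm_triangle_ineq) auto
      also have "\<dots> \<le> 2 * (cmod u)\<^sup>2 + 2 * (cmod v)\<^sup>2"
        using zero_le_power2[of "cmod u - cmod v"] by (simp add: power2_sum power2_diff)
      finally show ?thesis .
    qed
    fix \<theta>
    show "?F (\<lambda>z. f z + g z) \<theta> \<le> 2 * ?F f \<theta> + 2 * ?F g \<theta>"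
      using sq[of "f (of_real r * cis \<theta>)" "g (of_real r * cis \<theta>)"]
      by (simp add: field_simps)
  qed
qed

lemma H2_holomorphic: "f \<in> H2 \<Longrightarrow> f holomorphic_on ball 0 1"
  and H2_outside: "f \<in> H2 \<Longrightarrow> z \<notin> ball 0 1 \<Longrightarrow> f z = 0"
  by (auto simp: H2_def)

lemma H2_norm_nonneg: "0 \<le> H2_norm f" if "f \<in> H2"
proof -
  have "0 \<le> hardy_mean f (1/2)" by (rule hardy_mean_nonneg)
  also have "\<dots> \<le> (SUP r\<in>{0<..<1}. hardy_mean f r)"
    using that by (intro cSUP_upper) (auto simp: H2_def)
  finally show ?thesis by (simp add: H2_norm_def)
qed

lemma hardy_mean_le_H2_norm:
  assumes "f \<in> H2" "0 < r" "r < 1"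
  shows "hardy_mean f r \<le> (H2_norm f)\<^sup>2"
proof -
  have *: "hardy_mean f r \<le> (SUP r\<in>{0<..<1}. hardy_mean f r)"
    using assms by (intro cSUP_upper) (auto simp: H2_def)
  moreover have "0 \<le> hardy_mean f r" by (rule hardy_mean_nonneg)
  ultimately show ?thesis by (simp add: H2_norm_def)
qed

lemma H2_intro:
  assumes "f holomorphic_on ball 0 1" "\<And>z. z \<notin> ball 0 1 \<Longrightarrow> f z = 0" "0 \<le> B"
    and le: "\<And>r. 0 < r \<Longrightarrow> r < 1 \<Longrightarrow> hardy_mean f r \<le> B\<^sup>2"
  shows "f \<in> H2" "H2_norm f \<le> B"
proof -
  show "f \<in> H2" using assms by (auto simp: H2_def intro!: bdd_aboveI2[of _ _ "B\<^sup>2"])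
  have "(SUP r\<in>{0<..<1}. hardy_mean f r) \<le> B\<^sup>2"
    using le by (intro cSUP_least) auto
  then show "H2_norm f \<le> B" unfolding H2_norm_def by (rule real_le_lsqrt[rotated]) (use assms in auto)
qed

lemma holomorphic_sphere_continuous:
  assumes "f holomorphic_on ball 0 1" "r < 1"
  shows "continuous_on (sphere 0 r) f"
  using assms by (intro continuous_on_subset[OF holomorphic_on_imp_continuous_on]) auto

lemma H2_mult:
  assumes f: "f \<in> H2" and u: "u holomorphic_on ball 0 1" "\<And>z. z \<in> ball 0 1 \<Longrightarrow> cmod (u z) \<le> M" "0 \<le> M"
    and g: "\<And>z. z \<in> ball 0 1 \<Longrightarrow> g z = u z * f z" "\<And>z. z \<notin> ball 0 1 \<Longrightarrow> g z = 0"
  shows "g \<in> H2" "H2_norm g \<le> M * H2_norm f"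
proof -
  have hg: "g holomorphic_on ball 0 1"
    by (rule holomorphic_transform[OF holomorphic_on_mult[OF u(1) H2_holomorphic[OF f]]])
       (use g in auto)
  have le: "hardy_mean g r \<le> (M * H2_norm f)\<^sup>2" if "0 < r" "r < 1" for r
  proof -
    have "hardy_mean g r \<le> M\<^sup>2 * hardy_mean f r"
      using that g u H2_holomorphic[OF f]
      by (intro hardy_mean_mono holomorphic_sphere_continuous hg)
         (auto simp: norm_mult intro!: mult_right_mono)
    also have "\<dots> \<le> M\<^sup>2 * (H2_norm f)\<^sup>2"
      using that f by (intro mult_left_mono hardy_mean_le_H2_norm) auto
    finally show ?thesis by (simp add: power_mult_distrib)
  qed
  have "0 \<le> M * H2_norm f" using u H2_norm_nonneg[OF f] by simp
  from H2_intro[OF hg g(2) this le] show "g \<in> H2" "H2_norm g \<le> M * H2_norm f" by auto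
qed

lemma H2_scale:
  assumes "f \<in> H2"
  shows "(\<lambda>z. c * f z) \<in> H2" "H2_norm (\<lambda>z. c * f z) \<le> cmod c * H2_norm f"
  using H2_mult[OF assms, of "\<lambda>_. c" "cmod c" "\<lambda>z. c * f z"] H2_outside[OF assms] by auto

lemma H2_add:
  assumes "f \<in> H2" "g \<in> H2"
  shows "(\<lambda>z. f z + g z) \<in> H2" "H2_norm (\<lambda>z. f z + g z) \<le> 2 * (H2_norm f + H2_norm g)"
proof -
  have le: "hardy_mean (\<lambda>z. f z + g z) r \<le> (2 * (H2_norm f + H2_norm g))\<^sup>2"
    if "0 < r" "r < 1" for r
  proof -
    have "hardy_mean (\<lambda>z. f z + g z) r \<le> 2 * hardy_mean f r + 2 * hardy_mean g r"
      using that assms by (intro hardy_mean_add holomorphic_sphere_continuous H2_holomorphic) auto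
    also have "\<dots> \<le> 2 * (H2_norm f)\<^sup>2 + 2 * (H2_norm g)\<^sup>2"
      using that assms by (intro add_mono mult_left_mono hardy_mean_le_H2_norm) auto
    also have "\<dots> \<le> (2 * (H2_norm f + H2_norm g))\<^sup>2"
      using H2_norm_nonneg[OF assms(1)] H2_norm_nonneg[OF assms(2)]
      by (simp add: power2_eq_square algebra_simps)
    finally show ?thesis .
  qed
  have *: "(\<lambda>z. f z + g z) holomorphic_on ball 0 1" "0 \<le> 2 * (H2_norm f + H2_norm g)"
    "\<And>z. z \<notin> ball 0 1 \<Longrightarrow> f z + g z = 0"
    using assms by (intro holomorphic_on_add H2_holomorphic; simp)
      (use assms H2_norm_nonneg in \<open>auto simp: H2_outside[OF assms(1)] H2_outside[OF assms(2)]\<close>)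
  show "(\<lambda>z. f z + g z) \<in> H2" "H2_norm (\<lambda>z. f z + g z) \<le> 2 * (H2_norm f + H2_norm g)"
    using H2_intro[OF *(1) *(3) *(2) le] by blast+
qed

section \<open>Composition, point evaluation and series in the Hardy space\<close>

text \<open>
  Littlewood's subordination principle. The Poisson formula for \<open>F\<^sup>2\<close> bounds \<open>\<bar>F (\<phi> z)\<bar>\<^sup>2\<close> by
  an average of \<open>\<bar>F\<bar>\<^sup>2\<close> over the unit circle against the kernel at \<open>\<phi> z\<close>. After Fubini only
  the circle mean of this kernel in \<open>z\<close> is left, and as the real part of a holomorphic
  function it has its value at the centre, the kernel at \<open>\<phi> 0\<close>.
\<close>
lemma hardy_mean_compose_le:
  fixes F \<phi> :: "complex \<Rightarrow> complex"
  assumes cF: "continuous_on (cball 0 1) F" and hF: "F holomorphic_on ball 0 1"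
    and h\<phi>: "\<phi> holomorphic_on ball 0 1" and \<phi>: "\<And>z. z \<in> ball 0 1 \<Longrightarrow> \<phi> z \<in> ball 0 1"
    and \<rho>: "0 \<le> \<rho>" "\<rho> < 1"
  shows "hardy_mean (\<lambda>z. F (\<phi> z)) \<rho> \<le> (1 + cmod (\<phi> 0)) / (1 - cmod (\<phi> 0)) * hardy_mean F 1"
proof -
  define K where "K = (1 + cmod (\<phi> 0)) / (1 - cmod (\<phi> 0))"
  define P where "P t = \<phi> (of_real \<rho> * cis t)" for t
  have Pb: "cmod (P t) < 1" for t
    using \<phi>[of "of_real \<rho> * cis t"] \<rho> by (simp add: P_def norm_mult)
  have contP: "continuous_on S P" for S
    unfolding P_def
    by (rule continuous_on_compose2[OF holomorphic_on_imp_continuous_on[OF h\<phi>]])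
       (use \<rho> in \<open>auto intro!: continuous_intros simp: norm_mult\<close>)
  have contF: "continuous_on S (\<lambda>\<theta>. F (cis \<theta>))" for S
    by (rule continuous_on_compose2[OF cF]) (auto intro!: continuous_intros)
  have ne: "cis \<theta> \<noteq> P t" for \<theta> t
    using Pb[of t] by (metis norm_cis less_irrefl)
  define f where "f t \<theta> = (cmod (F (cis \<theta>)))\<^sup>2 / (2*pi) * (poisson_kernel (P t) (cis \<theta>) / (2*pi))" for t \<theta>
  have contf: "continuous_on (cbox (0, 0) (2*pi, 2*pi)) (\<lambda>(t, \<theta>). f t \<theta>)"
    unfolding f_def split_def poisson_kernel_def
    by (intro continuous_intros continuous_on_compose2[OF contF[of UNIV]]
          continuous_on_compose2[OF contP[of UNIV]]) (use ne in auto)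
  have intf: "f t integrable_on {0..2*pi}" for t
  proof -
    have "continuous_on {0..2*pi} (f t)"
      unfolding f_def poisson_kernel_def using ne by (intro continuous_intros contF) auto
    then show ?thesis by (rule integrable_continuous_real)
  qed
  have sub: "(cmod (F (P t)))\<^sup>2 / (2*pi) \<le> integral {0..2*pi} (f t)" for t
  proof -
    let ?g = "\<lambda>\<theta>. (F (cis \<theta>))\<^sup>2 * of_real (poisson_kernel (P t) (cis \<theta>))"
    have hi: "(?g has_integral (2*pi*(F (P t))\<^sup>2)) {0..2*pi}"
      by (rule poisson_integral[OF _ _ Pb]) (intro continuous_intros holomorphic_intros cF hF)+
    have "cmod (integral {0..2*pi} ?g) \<le> integral {0..2*pi} (\<lambda>\<theta>. (2*pi)\<^sup>2 * f t \<theta>)"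
    proof (rule integral_norm_bound_integral)
      show "?g integrable_on {0..2*pi}" using hi by blast
      show "(\<lambda>\<theta>. (2*pi)\<^sup>2 * f t \<theta>) integrable_on {0..2*pi}"
        by (rule integrable_on_mult_right[OF intf])
      show "cmod (?g \<theta>) \<le> (2*pi)\<^sup>2 * f t \<theta>" for \<theta>
        using poisson_nonneg[OF Pb, of t "cis \<theta>"]
        by (simp add: f_def norm_mult norm_power power2_eq_square)
    qed
    then show ?thesis
      unfolding integral_unique[OF hi] integral_mult_right
      by (simp add: norm_mult norm_power power2_eq_square field_simps)
  qed
  have mean: "integral {0..2*pi} (\<lambda>t. poisson_kernel (P t) \<zeta> / (2*pi)) = poisson_kernel (\<phi> 0) \<zeta>"
    if \<zeta>: "cmod \<zeta> = 1" for \<zeta>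
  proof -
    define G where "G z = (\<zeta> + \<phi> (of_real \<rho> * z)) / (\<zeta> - \<phi> (of_real \<rho> * z))" for z
    have in1: "of_real \<rho> * z \<in> ball 0 1" if "z \<in> cball 0 1" for z :: complex
    proof -
      have "\<rho> * cmod z \<le> \<rho>" using that \<rho> by (simp add: mult_left_le)
      then show ?thesis using \<rho> by (simp add: norm_mult)
    qed
    have h: "(\<lambda>z. \<phi> (of_real \<rho> * z)) holomorphic_on ball 0 1"
      by (rule holomorphic_on_compose_gen[unfolded o_def, OF _ h\<phi>])
         (use in1 in \<open>auto intro!: holomorphic_intros\<close>)
    have c: "continuous_on (cball 0 1) (\<lambda>z. \<phi> (of_real \<rho> * z))"
      by (rule continuous_on_compose2[OF holomorphic_on_imp_continuous_on[OF h\<phi>]])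
         (use in1 in \<open>auto intro!: continuous_intros\<close>)
    have ne\<zeta>: "\<zeta> - \<phi> (of_real \<rho> * z) \<noteq> 0" if "z \<in> cball 0 1" for z
      using \<phi>[OF in1[OF that]] \<zeta> by auto
    have "((\<lambda>\<theta>. G (cis \<theta>) * of_real (poisson_kernel 0 (cis \<theta>))) has_integral (2 * pi * G 0)) {0..2*pi}"
    proof (rule poisson_integral)
      show "continuous_on (cball 0 1) G"
        unfolding G_def using ne\<zeta> by (intro continuous_intros c) blast
      show "G holomorphic_on ball 0 1"
        unfolding G_def using ne\<zeta> by (intro holomorphic_intros h) simp
    qed simp
    then have 1: "((\<lambda>\<theta>. Re (G (cis \<theta>))) has_integral (2 * pi * Re (G 0))) {0..2*pi}"
      by (auto simp: poisson_kernel_def dest: has_integral_Re)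
    have Re: "Re ((\<zeta> + p) / (\<zeta> - p)) = poisson_kernel p \<zeta>" for p
    proof -
      have "Re ((\<zeta> + p) / (\<zeta> - p)) = Re ((\<zeta> + p) * cnj (\<zeta> - p)) / (cmod (\<zeta> - p))\<^sup>2"
        by (subst complex_div_cnj) (simp add: Re_divide_of_real del: complex_cnj_diff of_real_power)
      also have "Re ((\<zeta> + p) * cnj (\<zeta> - p)) = (cmod \<zeta>)\<^sup>2 - (cmod p)\<^sup>2"
        by (simp only: cmod_power2) (simp add: algebra_simps power2_eq_square)
      finally show ?thesis using \<zeta> by (simp add: poisson_kernel_def)
    qed
    from has_integral_divide[OF 1, of "2*pi"] show ?thesis
      by (intro integral_unique) (simp add: G_def Re P_def)
  qed
  have cFP: "continuous_on (sphere 0 \<rho>) (\<lambda>z. F (\<phi> z))"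
  proof (rule continuous_on_compose2[OF cF])
    show "continuous_on (sphere 0 \<rho>) \<phi>" by (rule holomorphic_sphere_continuous[OF h\<phi> \<rho>(2)])
    show "\<phi> ` sphere 0 \<rho> \<subseteq> cball 0 1" using \<phi> \<rho>(2) by force
  qed
  have "hardy_mean (\<lambda>z. F (\<phi> z)) \<rho> \<le> integral {0..2*pi} (\<lambda>t. integral {0..2*pi} (f t))"
    unfolding hardy_mean_def
  proof (rule integral_le)
    show "(\<lambda>\<theta>. (cmod (F (\<phi> (of_real \<rho> * cis \<theta>))))\<^sup>2 / (2*pi)) integrable_on {0..2*pi}"
      by (rule circle_integrable[OF cFP \<rho>(1)])
    show "(\<lambda>t. integral {0..2*pi} (f t)) integrable_on {0..2*pi}"
      using integral_integrable_2dim[OF contf] by simp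
  qed (use sub in \<open>simp add: P_def\<close>)
  also have "\<dots> = integral {0..2*pi} (\<lambda>\<theta>. integral {0..2*pi} (\<lambda>t. f t \<theta>))"
    using integral_swap_continuous[OF contf] by simp
  also have "\<dots> = integral {0..2*pi} (\<lambda>\<theta>. (cmod (F (cis \<theta>)))\<^sup>2 / (2*pi) * poisson_kernel (\<phi> 0) (cis \<theta>))"
    unfolding f_def integral_mult_right by (simp add: mean del: integral_divide)
  also have "\<dots> \<le> integral {0..2*pi} (\<lambda>\<theta>. K * ((cmod (F (cis \<theta>)))\<^sup>2 / (2*pi)))"
  proof (rule integral_le)
    have "cmod (\<phi> 0) < 1" using \<phi>[of 0] by simp
    then show "(cmod (F (cis \<theta>)))\<^sup>2 / (2*pi) * poisson_kernel (\<phi> 0) (cis \<theta>)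
        \<le> K * ((cmod (F (cis \<theta>)))\<^sup>2 / (2*pi))" for \<theta>
      using mult_right_mono[OF poisson_le[of "\<phi> 0" "cis \<theta>"], of "(cmod (F (cis \<theta>)))\<^sup>2 / (2*pi)"]
      by (simp add: K_def mult.commute)
    show "(\<lambda>\<theta>. K * ((cmod (F (cis \<theta>)))\<^sup>2 / (2*pi))) integrable_on {0..2*pi}"
      by (intro integrable_continuous_real continuous_intros contF) auto
    have "cis \<theta> \<noteq> \<phi> 0" for \<theta> using \<phi>[of 0] by (metis norm_cis less_irrefl mem_ball_0 centre_in_ball zero_less_one)
    then show "(\<lambda>\<theta>. (cmod (F (cis \<theta>)))\<^sup>2 / (2*pi) * poisson_kernel (\<phi> 0) (cis \<theta>)) integrable_on {0..2*pi}"
      unfolding poisson_kernel_def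
      by (intro integrable_continuous_real continuous_intros contF) auto
  qed
  also have "\<dots> = K * hardy_mean F 1"
    unfolding integral_mult_right hardy_mean_def by simp
  finally show ?thesis by (simp add: K_def)
qed

text \<open>
  The preceding bound applies to the dilates \<open>f (r z)\<close>, which are continuous up to the circle;
  the means on a fixed inner circle depend continuously on \<open>r\<close>, including \<open>r = 1\<close>.
\<close>
lemma H2_compose_mean:
  assumes f: "f \<in> H2" and h\<phi>: "\<phi> holomorphic_on ball 0 1"
    and \<phi>: "\<And>z. z \<in> ball 0 1 \<Longrightarrow> \<phi> z \<in> ball 0 1" and \<rho>: "0 \<le> \<rho>" "\<rho> < 1"
  shows "hardy_mean (\<lambda>z. f (\<phi> z)) \<rho> \<le> (1 + cmod (\<phi> 0)) / (1 - cmod (\<phi> 0)) * (H2_norm f)\<^sup>2"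
proof -
  define K where "K = (1 + cmod (\<phi> 0)) / (1 - cmod (\<phi> 0))"
  have K: "0 \<le> K" using \<phi>[of 0] by (simp add: K_def)
  define g where "g r = hardy_mean (\<lambda>z. f (of_real r * \<phi> z)) \<rho>" for r
  have lt: "r * cmod z < 1" if "0 \<le> r" "r \<le> 1" "cmod z < 1" for r and z :: complex
  proof -
    have "r * cmod z \<le> 1 * cmod z" using that by (intro mult_right_mono) auto
    then show ?thesis using that by simp
  qed
  have "continuous_on {0..1} g"
    unfolding g_def hardy_mean_def cbox_interval[symmetric]
  proof (rule integral_continuous_on_param)
    have cP: "continuous_on S (\<lambda>t. \<phi> (of_real \<rho> * cis t))" for S
      by (rule continuous_on_compose2[OF holomorphic_on_imp_continuous_on[OF h\<phi>]])
         (use \<rho> in \<open>auto intro!: continuous_intros simp: norm_mult\<close>)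
    have c: "continuous_on (cbox 0 1 \<times> cbox 0 (2*pi)) (\<lambda>x. f (of_real (fst x) * \<phi> (of_real \<rho> * cis (snd x))))"
    proof (rule continuous_on_compose2[OF holomorphic_on_imp_continuous_on[OF H2_holomorphic[OF f]]])
      show "continuous_on (cbox 0 1 \<times> cbox 0 (2*pi)) (\<lambda>x. of_real (fst x) * \<phi> (of_real \<rho> * cis (snd x)))"
        by (intro continuous_intros continuous_on_compose2[OF cP[of UNIV]]) auto
      have "cmod (\<phi> (of_real \<rho> * cis t)) < 1" for t
        using \<phi>[of "of_real \<rho> * cis t"] \<rho> by (simp add: norm_mult)
      then show "(\<lambda>x. of_real (fst x) * \<phi> (of_real \<rho> * cis (snd x))) ` (cbox 0 1 \<times> cbox 0 (2*pi)) \<subseteq> ball 0 1"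
        using lt by (auto simp: norm_mult)
    qed
    show "continuous_on (cbox 0 1 \<times> cbox 0 (2*pi))
      (\<lambda>(r, t). (cmod (f (of_real r * \<phi> (of_real \<rho> * cis t))))\<^sup>2 / (2*pi))"
      unfolding split_def by (intro continuous_intros c) auto
  qed
  then have cont: "continuous_on (closure {0<..<1}) g" by simp
  have le: "g r \<le> K * (H2_norm f)\<^sup>2" if r: "r \<in> {0<..<1}" for r
  proof -
    have in1: "of_real r * z \<in> ball 0 1" if "z \<in> cball 0 1" for z :: complex
    proof -
      have "r * cmod z \<le> r" using that r by (simp add: mult_left_le)
      then have "r * cmod z < 1" using r unfolding greaterThanLessThan_iff by linarith
      then show ?thesis using r by (simp add: norm_mult)
    qed
    have "g r \<le> K * hardy_mean (\<lambda>z. f (of_real r * z)) 1"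
      unfolding g_def K_def
    proof (rule hardy_mean_compose_le[OF _ _ h\<phi> \<phi> \<rho>])
      show "continuous_on (cball 0 1) (\<lambda>z. f (of_real r * z))"
        by (rule continuous_on_compose2[OF holomorphic_on_imp_continuous_on[OF H2_holomorphic[OF f]]])
           (use in1 in \<open>auto intro!: continuous_intros\<close>)
      show "(\<lambda>z. f (of_real r * z)) holomorphic_on ball 0 1"
        by (rule holomorphic_on_compose_gen[unfolded o_def, OF _ H2_holomorphic[OF f]])
           (use in1 in \<open>auto intro!: holomorphic_intros\<close>)
    qed auto
    also have "hardy_mean (\<lambda>z. f (of_real r * z)) 1 = hardy_mean f r"
      by (simp add: hardy_mean_def)
    also have "K * \<dots> \<le> K * (H2_norm f)\<^sup>2"
      using r f K by (intro mult_left_mono hardy_mean_le_H2_norm) auto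
    finally show ?thesis .
  qed
  have "g 1 \<le> K * (H2_norm f)\<^sup>2"
    by (rule continuous_le_on_closure[OF cont _ le]) auto
  then show ?thesis by (simp add: g_def K_def)
qed

lemma poisson_factor_le:
  assumes "cmod p < 1"
  shows "(1 + cmod p) / (1 - cmod p) \<le> 4 / (1 - (cmod p)\<^sup>2)"
proof -
  have "1 - (cmod p)\<^sup>2 = (1 - cmod p) * (1 + cmod p)" by (simp add: power2_eq_square algebra_simps)
  moreover have "1 + cmod p \<noteq> 0" using norm_ge_zero[of p] by linarith
  ultimately have "(1 + cmod p) / (1 - cmod p) = (1 + cmod p)\<^sup>2 / (1 - (cmod p)\<^sup>2)"
    by (simp add: power2_eq_square)
  also have "\<dots> \<le> 2\<^sup>2 / (1 - (cmod p)\<^sup>2)"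
    using assms by (intro divide_right_mono power_mono) (auto simp: power_le_one)
  finally show ?thesis by simp
qed

text \<open>
  A constant map is a holomorphic self-map of the disk, so point evaluation is a composition.
\<close>
lemma H2_eval_le:
  assumes f: "f \<in> H2" and p: "cmod p < 1"
  shows "cmod (f p) \<le> 2 / sqrt (1 - (cmod p)\<^sup>2) * H2_norm f"
proof -
  have "hardy_mean (\<lambda>z. f p) 0 \<le> (1 + cmod p) / (1 - cmod p) * (H2_norm f)\<^sup>2"
    by (rule H2_compose_mean[OF f, of "\<lambda>_. p"]) (use p in auto)
  also have "hardy_mean (\<lambda>z. f p) 0 = (cmod (f p))\<^sup>2" by (simp add: hardy_mean_def)
  also have "(1 + cmod p) / (1 - cmod p) * (H2_norm f)\<^sup>2 \<le> 4 / (1 - (cmod p)\<^sup>2) * (H2_norm f)\<^sup>2"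
    by (intro mult_right_mono poisson_factor_le p) auto
  also have "\<dots> = (2 / sqrt (1 - (cmod p)\<^sup>2) * H2_norm f)\<^sup>2"
    using p by (simp add: power_mult_distrib power_divide power_le_one)
  finally show ?thesis
    by (rule power2_le_imp_le) (use p H2_norm_nonneg[OF f] in \<open>auto simp: power_le_one\<close>)
qed

text \<open>
  The factor \<open>2 / sqrt (1 - \<bar>\<phi> 0\<bar>\<^sup>2)\<close> grows only linearly along the iterates of a parabolic
  automorphism. A spectral radius computed from this bound is therefore governed by the weight
  alone.
\<close>
lemma H2_weighted_composition:
  assumes f: "f \<in> H2" and h\<phi>: "\<phi> holomorphic_on ball 0 1"
    and \<phi>: "\<And>z. z \<in> ball 0 1 \<Longrightarrow> \<phi> z \<in> ball 0 1"
    and u: "u holomorphic_on ball 0 1" "\<And>z. z \<in> ball 0 1 \<Longrightarrow> cmod (u z) \<le> M"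
  shows "weighted_composition u \<phi> f \<in> H2"
    "H2_norm (weighted_composition u \<phi> f) \<le> M * (2 / sqrt (1 - (cmod (\<phi> 0))\<^sup>2)) * H2_norm f"
proof -
  define K where "K = 2 / sqrt (1 - (cmod (\<phi> 0))\<^sup>2)"
  have p: "cmod (\<phi> 0) < 1" using \<phi>[of 0] by simp
  have K: "0 \<le> K" "(1 + cmod (\<phi> 0)) / (1 - cmod (\<phi> 0)) \<le> K\<^sup>2"
    using p poisson_factor_le[OF p] by (auto simp: K_def power_le_one power_divide)
  define g where "g z = (if z \<in> ball 0 1 then f (\<phi> z) else 0)" for z
  have hg: "(\<lambda>z. f (\<phi> z)) holomorphic_on ball 0 1"
    by (rule holomorphic_on_compose_gen[unfolded o_def, OF h\<phi> H2_holomorphic[OF f]]) (use \<phi> in auto)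
  have M: "0 \<le> M" using order_trans[OF norm_ge_zero u(2)[of 0]] by simp
  have g: "g \<in> H2" "H2_norm g \<le> K * H2_norm f"
  proof -
    have 1: "g holomorphic_on ball 0 1"
      by (rule holomorphic_transform[OF hg]) (simp add: g_def)
    have 2: "hardy_mean g r \<le> (K * H2_norm f)\<^sup>2" if "0 < r" "r < 1" for r
    proof -
      have "hardy_mean g r = hardy_mean (\<lambda>z. f (\<phi> z)) r"
        unfolding hardy_mean_def g_def using that by (simp add: norm_mult)
      also have "\<dots> \<le> (1 + cmod (\<phi> 0)) / (1 - cmod (\<phi> 0)) * (H2_norm f)\<^sup>2"
        using that by (intro H2_compose_mean f h\<phi> \<phi>) auto
      also have "\<dots> \<le> K\<^sup>2 * (H2_norm f)\<^sup>2" using K by (intro mult_right_mono) auto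
      finally show ?thesis by (simp add: power_mult_distrib)
    qed
    have 3: "0 \<le> K * H2_norm f" using K H2_norm_nonneg[OF f] by simp
    have 4: "g z = 0" if "z \<notin> ball 0 1" for z using that by (simp add: g_def)
    show "g \<in> H2" "H2_norm g \<le> K * H2_norm f" using H2_intro[OF 1 4 3 2] by blast+
  qed
  have "weighted_composition u \<phi> f \<in> H2 \<and> H2_norm (weighted_composition u \<phi> f) \<le> M * H2_norm g"
    using H2_mult[OF g(1) u M, of "weighted_composition u \<phi> f"]
    by (auto simp: weighted_composition_def g_def)
  moreover have "M * H2_norm g \<le> M * (K * H2_norm f)" using g M by (intro mult_left_mono)
  ultimately show "weighted_composition u \<phi> f \<in> H2"
    "H2_norm (weighted_composition u \<phi> f) \<le> M * (2 / sqrt (1 - (cmod (\<phi> 0))\<^sup>2)) * H2_norm f"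
    by (auto simp: K_def mult.assoc)
qed

text \<open>
  On the circle of radius \<open>r\<close>, \<open>1 / \<bar>1 - cnj w z\<bar>\<^sup>2\<close> is a multiple of the Poisson kernel at
  \<open>r w\<close>.
\<close>
lemma hardy_mean_kernel_le:
  assumes w: "cmod w < 1" and r: "0 \<le> r" "r < 1"
  shows "hardy_mean (\<lambda>z. 1 / (1 - cnj w * z)) r \<le> 1 / (1 - (cmod w)\<^sup>2)"
proof -
  define p where "p = of_real r * w"
  have pr: "cmod p \<le> cmod w" using r by (simp add: p_def norm_mult mult_le_one mult_left_le_one_le)
  with w have p: "cmod p < 1" by simp
  have "((\<lambda>\<theta>. (1::complex) * of_real (poisson_kernel p (cis \<theta>))) has_integral (2 * pi * (1::complex))) {0..2*pi}"
    by (rule poisson_integral[OF _ _ p, of "\<lambda>_. 1"]) auto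
  then have 1: "((\<lambda>\<theta>. poisson_kernel p (cis \<theta>)) has_integral (2*pi)) {0..2*pi}"
    by (auto dest: has_integral_Re)
  have sq: "(cmod (1 / (1 - cnj w * (of_real r * cis \<theta>))))\<^sup>2 / (2*pi) =
      poisson_kernel p (cis \<theta>) * (1 / ((1 - (cmod p)\<^sup>2) * (2*pi)))" for \<theta>
  proof -
    have "cis \<theta> * cnj (cis \<theta> - p) = 1 - cnj w * (of_real r * cis \<theta>)"
      using complex_norm_square[of "cis \<theta>"] by (simp add: p_def algebra_simps del: cis_cnj)
    then have "cmod (1 - cnj w * (of_real r * cis \<theta>)) = cmod (cis \<theta> - p)"
      by (metis complex_mod_cnj mult_1 norm_cis norm_mult)
    moreover have "(cmod p)\<^sup>2 < 1" using p by (simp add: power_less_one_iff)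
    ultimately show ?thesis by (simp add: poisson_kernel_def norm_divide power_divide)
  qed
  have "hardy_mean (\<lambda>z. 1 / (1 - cnj w * z)) r = 2*pi * (1 / ((1 - (cmod p)\<^sup>2) * (2*pi)))"
    unfolding hardy_mean_def sq by (rule integral_unique[OF has_integral_mult_left[OF 1]])
  also have "\<dots> = 1 / (1 - (cmod p)\<^sup>2)" by simp
  also have "\<dots> \<le> 1 / (1 - (cmod w)\<^sup>2)"
    using pr w power_mono[OF pr, of 2] by (intro divide_left_mono) (auto simp: power_less_one_iff power_le_one zero_less_mult_iff)
  finally show ?thesis .
qed

text \<open>
  Cauchy--Schwarz with the geometric weights \<open>q ^ n\<close>; it stands in for the triangle inequality
  of the norm and passes to infinite sums termwise under the integral.
\<close>
lemma norm_sum_squared_le: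
  fixes x :: "nat \<Rightarrow> complex"
  assumes q: "0 < q" "q < 1"
  shows "(cmod (\<Sum>n<N. x n))\<^sup>2 \<le> 1 / (1 - q) * (\<Sum>n<N. (cmod (x n))\<^sup>2 / q ^ n)"
proof -
  have "cmod (\<Sum>n<N. x n) \<le> (\<Sum>n<N. sqrt (q ^ n) * (cmod (x n) / sqrt (q ^ n)))"
    using q by (intro order_trans[OF norm_sum] sum_mono) auto
  then have "(cmod (\<Sum>n<N. x n))\<^sup>2 \<le> (\<Sum>n<N. sqrt (q ^ n) * (cmod (x n) / sqrt (q ^ n)))\<^sup>2"
    by (intro power_mono) auto
  also have "\<dots> \<le> (\<Sum>n<N. (sqrt (q ^ n))\<^sup>2) * (\<Sum>n<N. (cmod (x n) / sqrt (q ^ n))\<^sup>2)"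
    by (rule Cauchy_Schwarz_ineq_sum)
  also have "\<dots> = (\<Sum>n<N. q ^ n) * (\<Sum>n<N. (cmod (x n))\<^sup>2 / q ^ n)"
    using q by (simp add: power_divide)
  also have "\<dots> \<le> 1 / (1 - q) * (\<Sum>n<N. (cmod (x n))\<^sup>2 / q ^ n)"
    using q sum_le_suminf[of "\<lambda>n. q ^ n" "{..<N}"]
    by (intro mult_right_mono sum_nonneg) (auto simp: suminf_geometric summable_geometric)
  finally show ?thesis .
qed

text \<open>
  Absolute convergence of geometrically bounded series. Point evaluation turns the norm bounds
  into uniform convergence on smaller disks, so the pointwise sum is holomorphic; its means
  are controlled by the weighted sum of squares of \<open>norm_sum_squared_le\<close>.
\<close>
lemma H2_series:
  assumes u: "\<And>n. u n \<in> H2" "\<And>n. H2_norm (u n) \<le> B * q ^ n"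
    and q: "0 < q" "q < 1" and B: "0 \<le> B"
  shows "summable (\<lambda>n. u n z)"
    and "(\<lambda>z. \<Sum>n. u n z) \<in> H2"
    and "H2_norm (\<lambda>z. \<Sum>n. u n z) \<le> B / (1 - q)"
proof -
  have sq: "summable (\<lambda>n. c * q ^ n)" for c :: real
    using q by (intro summable_mult summable_geometric) auto
  have eval: "cmod (u n z) \<le> 2 / sqrt (1 - r\<^sup>2) * B * q ^ n" if "cmod z \<le> r" "r < 1" for n z r
  proof -
    have r0: "0 \<le> r" using that(1) norm_ge_zero[of z] by linarith
    have rr: "r\<^sup>2 < 1" using that r0 by (simp add: power_less_one_iff)
    have zr: "(cmod z)\<^sup>2 \<le> r\<^sup>2" using that by (intro power_mono) auto
    have "cmod (u n z) \<le> 2 / sqrt (1 - (cmod z)\<^sup>2) * H2_norm (u n)"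
      using that by (intro H2_eval_le u) auto
    also have "\<dots> \<le> 2 / sqrt (1 - r\<^sup>2) * (B * q ^ n)"
      using rr zr H2_norm_nonneg[OF u(1)]
      by (intro mult_mono u divide_left_mono real_sqrt_le_mono mult_pos_pos) auto
    finally show ?thesis by (simp add: mult.assoc)
  qed
  show summ: "summable (\<lambda>n. u n z)" for z
  proof (cases "cmod z < 1")
    case True
    show ?thesis
      by (rule summable_comparison_test'[OF sq]) (rule eval[OF order_refl True])
  qed (use H2_outside[OF u(1)] in simp)
  have unif: "uniform_limit (cball 0 r) (\<lambda>N z. \<Sum>n<N. u n z) (\<lambda>z. \<Sum>n. u n z) sequentially"
    if "r < 1" for r
    by (rule Weierstrass_m_test[OF eval[OF _ that] sq]) auto
  have hol: "(\<lambda>z. \<Sum>n. u n z) holomorphic_on ball 0 1"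
  proof (rule holomorphic_uniform_sequence[OF open_ball])
    show "(\<lambda>z. \<Sum>n<N. u n z) holomorphic_on ball 0 1" for N
      by (intro holomorphic_intros H2_holomorphic u)
    fix x :: complex assume x: "x \<in> ball 0 1"
    define d where "d = (1 - cmod x) / 2"
    have d: "d > 0" "d + cmod x < 1" using x by (auto simp: d_def field_simps)
    have sub: "cball x d \<subseteq> cball 0 (d + cmod x)" by (simp add: cball_subset_cball_iff dist_norm)
    have "cball x d \<subseteq> ball 0 1" using sub d(2) by (auto simp: subset_iff)
    moreover have "uniform_limit (cball x d) (\<lambda>N z. \<Sum>n<N. u n z) (\<lambda>z. \<Sum>n. u n z) sequentially"
      by (rule uniform_limit_on_subset[OF unif[OF d(2)] sub])
    ultimately show "\<exists>d>0. cball x d \<subseteq> ball 0 1 \<and>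
        uniform_limit (cball x d) (\<lambda>N z. \<Sum>n<N. u n z) (\<lambda>z. \<Sum>n. u n z) sequentially"
      using d by blast
  qed
  have le: "hardy_mean (\<lambda>z. \<Sum>n. u n z) r \<le> (B / (1 - q))\<^sup>2" if r: "0 < r" "r < 1" for r
  proof -
    define pt where "pt \<theta> = of_real r * cis \<theta>" for \<theta>
    have pt: "cmod (pt \<theta>) = r" for \<theta> using r by (simp add: pt_def norm_mult)
    define a where "a n \<theta> = 1 / (1 - q) * ((cmod (u n (pt \<theta>)))\<^sup>2 / (2*pi) / q ^ n)" for n \<theta>
    have ca: "continuous_on {0..2*pi} (a n)" for n
    proof -
      have "continuous_on {0..2*pi} (\<lambda>\<theta>. u n (pt \<theta>))"
        unfolding pt_def
        by (rule continuous_on_compose2[OF holomorphic_on_imp_continuous_on[OF H2_holomorphic[OF u(1)]]])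
           (use r in \<open>auto intro!: continuous_intros simp: norm_mult\<close>)
      then show ?thesis unfolding a_def using q by (intro continuous_intros) auto
    qed
    have ia: "(a n has_integral (1 / (1 - q) * (hardy_mean (u n) r / q ^ n))) {0..2*pi}" for n
      using integrable_integral[OF integrable_continuous_real[OF ca[of n]]]
      unfolding a_def hardy_mean_def pt_def by simp
    define C where "C = 1 / (1 - q) * ((2 / sqrt (1 - r\<^sup>2) * B)\<^sup>2 / (2*pi))"
    have ub: "norm (a n \<theta>) \<le> C * q ^ n" for n \<theta>
    proof -
      have "(cmod (u n (pt \<theta>)))\<^sup>2 \<le> (2 / sqrt (1 - r\<^sup>2) * B * q ^ n)\<^sup>2"
        using pt[of \<theta>] r by (intro power_mono eval) auto
      then have "(cmod (u n (pt \<theta>)))\<^sup>2 / (2*pi) / q ^ n \<le> (2 / sqrt (1 - r\<^sup>2) * B * q ^ n)\<^sup>2 / (2*pi) / q ^ n"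
        using q by (intro divide_right_mono) auto
      also have "\<dots> = (2 / sqrt (1 - r\<^sup>2) * B)\<^sup>2 / (2*pi) * q ^ n"
        using q by (simp add: power_mult_distrib power2_eq_square)
      finally have "a n \<theta> \<le> 1 / (1 - q) * ((2 / sqrt (1 - r\<^sup>2) * B)\<^sup>2 / (2*pi) * q ^ n)"
        unfolding a_def using q by (intro mult_left_mono) auto
      moreover have "0 \<le> a n \<theta>" unfolding a_def using q by simp
      ultimately show ?thesis by (simp add: C_def mult.assoc)
    qed
    have sa: "summable (\<lambda>n. a n \<theta>)" for \<theta>
      by (rule summable_comparison_test'[OF sq]) (rule ub)
    have "uniform_limit {0..2*pi} (\<lambda>N \<theta>. \<Sum>n<N. a n \<theta>) (\<lambda>\<theta>. \<Sum>n. a n \<theta>) sequentially"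
      by (rule Weierstrass_m_test[OF ub sq])
    moreover have "continuous_on {0..2*pi} (\<lambda>\<theta>. \<Sum>n<N. a n \<theta>)" for N
      by (intro continuous_intros ca)
    ultimately obtain I J where
      I: "\<And>N. ((\<lambda>\<theta>. \<Sum>n<N. a n \<theta>) has_integral I N) {0..2*pi}" and
      J: "((\<lambda>\<theta>. \<Sum>n. a n \<theta>) has_integral J) {0..2*pi}" and lim: "I \<longlonglongrightarrow> J"
      by (rule uniform_limit_integral) auto
    have "I N \<le> (B / (1 - q))\<^sup>2" for N
    proof -
      have "((\<lambda>\<theta>. \<Sum>n<N. a n \<theta>) has_integral (\<Sum>n<N. 1 / (1 - q) * (hardy_mean (u n) r / q ^ n))) {0..2*pi}"
        by (intro has_integral_sum ia) auto
      with I[of N] have "I N = (\<Sum>n<N. 1 / (1 - q) * (hardy_mean (u n) r / q ^ n))"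
        by (rule has_integral_unique)
      also have "\<dots> \<le> (\<Sum>n<N. 1 / (1 - q) * (B\<^sup>2 * q ^ n))"
      proof (intro sum_mono mult_left_mono)
        fix n
        have "hardy_mean (u n) r \<le> (H2_norm (u n))\<^sup>2" by (intro hardy_mean_le_H2_norm u r)
        also have "\<dots> \<le> (B * q ^ n)\<^sup>2" by (intro power_mono u H2_norm_nonneg)
        finally show "hardy_mean (u n) r / q ^ n \<le> B\<^sup>2 * q ^ n"
          using q by (simp add: field_simps power2_eq_square)
      qed (use q in simp)
      also have "\<dots> = B\<^sup>2 / (1 - q) * (\<Sum>n<N. q ^ n)" by (simp add: sum_distrib_left)
      also have "\<dots> \<le> B\<^sup>2 / (1 - q) * (1 / (1 - q))"
        using q sum_le_suminf[of "\<lambda>n. q ^ n" "{..<N}"]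
        by (intro mult_left_mono) (auto simp: suminf_geometric summable_geometric)
      finally show ?thesis by (simp add: power2_eq_square)
    qed
    then have "J \<le> (B / (1 - q))\<^sup>2" using lim by (intro LIMSEQ_le_const2) auto
    moreover have "hardy_mean (\<lambda>z. \<Sum>n. u n z) r \<le> J"
      unfolding hardy_mean_def integral_unique[OF J, symmetric] pt_def[symmetric]
    proof (rule integral_le)
      show "(\<lambda>\<theta>. \<Sum>n. a n \<theta>) integrable_on {0..2*pi}" using J by blast
      show "(\<lambda>\<theta>. (cmod (\<Sum>n. u n (pt \<theta>)))\<^sup>2 / (2*pi)) integrable_on {0..2*pi}"
        unfolding pt_def using r
        by (intro circle_integrable holomorphic_sphere_continuous[OF hol]) auto
      show "(cmod (\<Sum>n. u n (pt \<theta>)))\<^sup>2 / (2*pi) \<le> (\<Sum>n. a n \<theta>)" for \<theta>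
      proof (rule LIMSEQ_le)
        show "(\<lambda>N. (cmod (\<Sum>n<N. u n (pt \<theta>)))\<^sup>2 / (2*pi)) \<longlonglongrightarrow> (cmod (\<Sum>n. u n (pt \<theta>)))\<^sup>2 / (2*pi)"
          by (intro tendsto_intros summable_LIMSEQ summ) auto
        show "(\<lambda>N. \<Sum>n<N. a n \<theta>) \<longlonglongrightarrow> (\<Sum>n. a n \<theta>)" by (rule summable_LIMSEQ[OF sa])
        show "\<exists>N. \<forall>n\<ge>N. (cmod (\<Sum>n<n. u n (pt \<theta>)))\<^sup>2 / (2*pi) \<le> (\<Sum>n<n. a n \<theta>)"
        proof (intro exI allI impI)
          fix N :: nat
          have "(cmod (\<Sum>n<N. u n (pt \<theta>)))\<^sup>2 / (2*pi)
              \<le> (1 / (1 - q) * (\<Sum>n<N. (cmod (u n (pt \<theta>)))\<^sup>2 / q ^ n)) / (2*pi)"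
            by (intro divide_right_mono norm_sum_squared_le q) auto
          also have "\<dots> = (\<Sum>n<N. a n \<theta>)"
            by (simp add: a_def sum_distrib_left sum_divide_distrib field_simps)
          finally show "(cmod (\<Sum>n<N. u n (pt \<theta>)))\<^sup>2 / (2*pi) \<le> (\<Sum>n<N. a n \<theta>)" .
        qed
      qed
    qed
    ultimately show ?thesis by linarith
  qed
  have "0 \<le> B / (1 - q)" using B q by simp
  moreover have "(\<Sum>n. u n z) = 0" if "z \<notin> ball 0 1" for z
    using H2_outside[OF u(1) that] by simp
  ultimately show "(\<lambda>z. \<Sum>n. u n z) \<in> H2" "H2_norm (\<lambda>z. \<Sum>n. u n z) \<le> B / (1 - q)"
    using H2_intro[OF hol _ _ le] by blast+
qed

section \<open>The Cayley transform and the parabolic flow\<close>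

definition cayley :: "complex \<Rightarrow> complex \<Rightarrow> complex" where
  "cayley a z = (a + z) / (a - z)"

text \<open>
  In the coordinate \<open>cayley a\<close>, which maps the disk to the right half-plane and \<open>a\<close> to
  infinity, this is the translation by \<open>\<i> t\<close>, see \<open>cayley_flow\<close>.
\<close>
definition parabolic_flow :: "complex \<Rightarrow> real \<Rightarrow> complex \<Rightarrow> complex" where
  "parabolic_flow a t z = a * (2 * z + \<i> * of_real t * (a - z)) / (2 * a + \<i> * of_real t * (a - z))"

lemma Re_cayley:
  assumes "cmod a = 1"
  shows "Re (cayley a z) = (1 - (cmod z)\<^sup>2) / (cmod (a - z))\<^sup>2"
proof -
  have "Re (cayley a z) = Re ((a + z) * cnj (a - z)) / (cmod (a - z))\<^sup>2"
    unfolding cayley_def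
    by (subst complex_div_cnj) (simp add: Re_divide_of_real del: complex_cnj_diff of_real_power)
  also have "Re ((a + z) * cnj (a - z)) = (cmod a)\<^sup>2 - (cmod z)\<^sup>2"
    by (simp only: cmod_power2) (simp add: algebra_simps power2_eq_square)
  finally show ?thesis using assms by simp
qed

lemma cayley_inj:
  assumes "a \<noteq> 0" "z \<noteq> a" "w \<noteq> a" "cayley a z = cayley a w"
  shows "z = w"
proof -
  have "2 * a * (z - w) = 0"
    using assms by (simp add: cayley_def field_simps)
  then show ?thesis using assms by simp
qed

locale boundary_point =
  fixes a :: complex
  assumes norm_a: "cmod a = 1"
begin

lemma a_nz: "a \<noteq> 0" using norm_a by auto

lemma Re_cayley_pos: "z \<in> ball 0 1 \<Longrightarrow> 0 < Re (cayley a z)"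
  using norm_a by (auto simp: Re_cayley intro!: divide_pos_pos simp: power_less_one_iff)

lemma in_ball_iff: "z \<noteq> a \<Longrightarrow> z \<in> ball 0 1 \<longleftrightarrow> 0 < Re (cayley a z)"
  using norm_a by (simp add: Re_cayley zero_less_divide_iff power_less_one_iff)

lemma ball_ne: "z \<in> ball 0 1 \<Longrightarrow> z \<noteq> a"
  using norm_a by auto

lemma one_plus_cayley: "z \<noteq> a \<Longrightarrow> 1 + cayley a z = 2 * a / (a - z)"
  by (simp add: cayley_def field_simps)

lemma one_minus_norm_sq:
  assumes z: "z \<in> ball 0 1"
  shows "1 - (cmod z)\<^sup>2 = 4 * Re (cayley a z) / (cmod (1 + cayley a z))\<^sup>2"
  using ball_ne[OF z] norm_a
  by (simp add: one_plus_cayley Re_cayley norm_a norm_divide norm_mult power_divide)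

lemma evaluation_factor:
  assumes z: "z \<in> ball 0 1"
  shows "2 / sqrt (1 - (cmod z)\<^sup>2) = cmod (1 + cayley a z) / sqrt (Re (cayley a z))"
  using Re_cayley_pos[OF z] by (simp add: one_minus_norm_sq[OF z] real_sqrt_divide real_sqrt_mult)

lemma flow_denominator_nz:
  assumes z: "z \<in> ball 0 1"
  shows "2 * a + \<i> * of_real t * (a - z) \<noteq> 0"
proof -
  have "(a - z) * (1 + cayley a z) = 2 * a" using ball_ne[OF z] by (simp add: one_plus_cayley)
  then have "2 * a + \<i> * of_real t * (a - z) = (a - z) * (1 + cayley a z + \<i> * of_real t)"
    by (simp add: distrib_left mult_ac)
  moreover have "Re (1 + cayley a z + \<i> * of_real t) > 0" using Re_cayley_pos[OF z] by simp
  then have "1 + cayley a z + \<i> * of_real t \<noteq> 0" by (metis less_irrefl zero_complex.sel(1))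
  ultimately show ?thesis using ball_ne[OF z] by auto
qed

lemma a_minus_flow:
  assumes z: "z \<in> ball 0 1"
  shows "a - parabolic_flow a t z = 2 * a * (a - z) / (2 * a + \<i> * of_real t * (a - z))"
  using flow_denominator_nz[OF z, of t] by (simp add: parabolic_flow_def divide_simps) (simp add: algebra_simps)

lemma flow_ne: "z \<in> ball 0 1 \<Longrightarrow> parabolic_flow a t z \<noteq> a"
  using a_minus_flow[of z t] flow_denominator_nz[of z t] a_nz ball_ne[of z] by auto

lemma cayley_flow:
  assumes z: "z \<in> ball 0 1"
  shows "cayley a (parabolic_flow a t z) = cayley a z + \<i> * of_real t"
proof -
  have "1 + cayley a (parabolic_flow a t z) = (2 * a + \<i> * of_real t * (a - z)) / (a - z)"
    using flow_denominator_nz[OF z, of t] ball_ne[OF z] a_nz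
    by (simp add: one_plus_cayley[OF flow_ne[OF z]] a_minus_flow[OF z])
  also have "\<dots> = 1 + cayley a z + \<i> * of_real t"
    using ball_ne[OF z] by (simp add: one_plus_cayley add_divide_distrib)
  finally show ?thesis by (simp add: add.assoc)
qed

lemma flow_in_ball: "z \<in> ball 0 1 \<Longrightarrow> parabolic_flow a t z \<in> ball 0 1"
  using Re_cayley_pos[of z] by (simp only: in_ball_iff[OF flow_ne] cayley_flow) simp

lemma flow_holomorphic: "parabolic_flow a t holomorphic_on ball 0 1"
  unfolding parabolic_flow_def using flow_denominator_nz[of _ t] by (intro holomorphic_intros) auto

lemma flow_eqI:
  assumes "z \<in> ball 0 1" "w \<in> ball 0 1" "cayley a w = cayley a z + \<i> * of_real t"
  shows "parabolic_flow a t z = w"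
  by (rule cayley_inj[OF a_nz flow_ne[OF assms(1)] ball_ne[OF assms(2)]])
     (simp only: cayley_flow[OF assms(1)] assms(3))

lemma flow_flow:
  assumes z: "z \<in> ball 0 1"
  shows "parabolic_flow a s (parabolic_flow a t z) = parabolic_flow a (t + s) z"
  by (rule flow_eqI)
     (simp_all only: flow_in_ball z cayley_flow[OF z] of_real_add distrib_left add.assoc)

lemma flow_zero: "z \<in> ball 0 1 \<Longrightarrow> parabolic_flow a 0 z = z"
  by (rule flow_eqI) auto

lemma norm_cayley_flow_ge:
  assumes "z \<in> ball 0 1"
  shows "\<bar>t\<bar> - cmod (cayley a z) \<le> cmod (cayley a (parabolic_flow a t z))"
  unfolding cayley_flow[OF assms]
  using norm_diff_ineq[of "\<i> * of_real t" "cayley a z"]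
  by (metis add.commute norm_ii norm_mult norm_of_real mult_1)

lemma norm_cayley_flow_le:
  assumes "z \<in> ball 0 1"
  shows "cmod (cayley a (parabolic_flow a t z)) \<le> cmod (cayley a z) + \<bar>t\<bar>"
  unfolding cayley_flow[OF assms]
  using norm_triangle_ineq[of "cayley a z" "\<i> * of_real t"] by (simp add: norm_mult)

lemma flow_factor:
  assumes z: "z \<in> ball 0 1"
  shows "2 / sqrt (1 - (cmod (parabolic_flow a t z))\<^sup>2) \<le> (1 + cmod (cayley a z) + \<bar>t\<bar>) / sqrt (Re (cayley a z))"
proof -
  have "2 / sqrt (1 - (cmod (parabolic_flow a t z))\<^sup>2) =
      cmod (1 + cayley a (parabolic_flow a t z)) / sqrt (Re (cayley a z))"
    by (simp add: evaluation_factor[OF flow_in_ball[OF z]] cayley_flow[OF z])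
  also have "\<dots> \<le> (1 + cmod (cayley a z) + \<bar>t\<bar>) / sqrt (Re (cayley a z))"
    using norm_triangle_ineq[of 1 "cayley a (parabolic_flow a t z)"] norm_cayley_flow_le[OF z, of t]
      Re_cayley_pos[OF z]
    by (intro divide_right_mono) auto
  finally show ?thesis .
qed

text \<open>
  Neighbourhoods of \<open>a\<close> in the disk are neighbourhoods of infinity in the half-plane.
\<close>
lemma tendsto_boundary_cayley:
  assumes lim: "(\<psi> \<longlongrightarrow> l) (at a within ball 0 1)" and e: "0 < e"
  shows "\<exists>R>0. \<forall>z\<in>ball 0 1. R \<le> cmod (cayley a z) \<longrightarrow> cmod (\<psi> z - l) < e"
proof -
  obtain d where d: "d > 0" "\<And>z. z \<in> ball 0 1 \<Longrightarrow> 0 < dist z a \<Longrightarrow> dist z a < d \<Longrightarrow> dist (\<psi> z) l < e"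
    using lim e unfolding Lim_within by blast
  have "cmod (\<psi> z - l) < e" if z: "z \<in> ball 0 1" "2 / d \<le> cmod (cayley a z)" for z
  proof -
    have p: "0 < cmod (a - z)" using ball_ne[OF z(1)] by simp
    have "2 / d * cmod (a - z) \<le> cmod (a + z)"
      using z(2) p by (simp add: cayley_def norm_divide pos_le_divide_eq)
    also have "\<dots> < 2" using norm_triangle_ineq[of a z] norm_a z(1) by simp
    finally have "cmod (a - z) < d" using d by (simp add: field_simps)
    then show ?thesis using d(2)[OF z(1)] p by (simp add: dist_norm norm_minus_commute)
  qed
  then show ?thesis using d by (intro exI[of _ "2/d"]) auto
qed

text \<open>
  The base of the power has the value 1 at \<open>z\<close> and is strictly smaller in modulus at all other
  points of the flow line through \<open>z\<close>. Up to the bounded factor \<open>(a - w) / (a - z)\<close> it is a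
  multiple of the reproducing kernel at \<open>z\<close>, and its norm is at most of the order
  \<open>sqrt (Re (cayley a z))\<close>, which offsets the size of the point evaluation at \<open>z\<close> as long as
  \<open>cayley a z\<close> stays bounded.
\<close>
lemma H2_peak_function:
  assumes z: "z \<in> ball 0 1"
  shows "\<exists>g\<in>H2. H2_norm g \<le> 2 ^ Suc m * sqrt (Re (cayley a z)) \<and>
    (\<forall>w\<in>ball 0 1. g w = (2 * of_real (Re (cayley a z)) / (cayley a w + cnj (cayley a z))) ^ Suc m)"
proof -
  define x where "x = Re (cayley a z)"
  have x: "0 < x" using Re_cayley_pos[OF z] by (simp add: x_def)
  define p where "p w = 2 * of_real x / (cayley a w + cnj (cayley a z))" for w
  have big: "x \<le> cmod (cayley a w + cnj (cayley a z))" if "w \<in> ball 0 1" for w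
    using complex_Re_le_cmod[of "cayley a w + cnj (cayley a z)"] Re_cayley_pos[OF that]
    by (simp add: x_def)
  have nz: "cayley a w + cnj (cayley a z) \<noteq> 0" if "w \<in> ball 0 1" for w
    using big[OF that] x by auto
  have p2: "cmod (p w) \<le> 2" if "w \<in> ball 0 1" for w
    using big[OF that] x nz[OF that] by (simp add: p_def norm_divide norm_mult divide_le_eq)
  have holp: "p holomorphic_on ball 0 1"
    unfolding p_def cayley_def using nz ball_ne by (intro holomorphic_intros) (auto simp: cayley_def)
  have knz: "1 - cnj z * w \<noteq> 0" if "w \<in> ball 0 1" for w
  proof -
    have "cmod (cnj z * w) < 1" using z that norm_mult_less[of "cnj z" 1 w 1] by simp
    then show ?thesis by (metis less_irrefl norm_one right_minus_eq)
  qed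
  have holk: "(\<lambda>w. 1 / (1 - cnj z * w)) holomorphic_on ball 0 1"
    using knz by (intro holomorphic_intros) auto
  have pk: "cmod (p w) \<le> (2 * x * cmod (a - z)) * cmod (1 / (1 - cnj z * w))" if w: "w \<in> ball 0 1" for w
  proof -
    have "cayley a w + cnj (cayley a z) = 2 * (1 - cnj z * w) / ((a - w) * cnj (a - z))"
    proof -
      have "a * cnj a = 1" using norm_a by (simp add: complex_norm_square[symmetric])
      then show ?thesis using ball_ne[OF w] ball_ne[OF z]
        by (simp add: cayley_def divide_simps) (simp add: algebra_simps)
    qed
    then have "cmod (p w) = x * cmod (a - w) * cmod (a - z) * cmod (1 / (1 - cnj z * w))"
      using x by (simp add: p_def norm_divide norm_mult del: complex_cnj_diff right_diff_distrib_numeral)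
    also have "\<dots> \<le> x * 2 * cmod (a - z) * cmod (1 / (1 - cnj z * w))"
      using x w norm_a norm_triangle_ineq4[of a w] by (intro mult_right_mono mult_left_mono) auto
    finally show ?thesis by (simp add: mult_ac)
  qed
  define g0 where "g0 w = (if w \<in> ball 0 1 then p w else 0)" for w
  have g0: "g0 \<in> H2 \<and> H2_norm g0 \<le> 2 * sqrt x"
  proof -
    have 1: "g0 holomorphic_on ball 0 1" by (rule holomorphic_transform[OF holp]) (simp add: g0_def)
    have 2: "hardy_mean g0 r \<le> (2 * sqrt x)\<^sup>2" if r: "0 < r" "r < 1" for r
    proof -
      have "hardy_mean g0 r \<le> (2 * x * cmod (a - z))\<^sup>2 * hardy_mean (\<lambda>w. 1 / (1 - cnj z * w)) r"
        using r by (intro hardy_mean_mono holomorphic_sphere_continuous 1 holk)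
          (use pk in \<open>auto simp: g0_def\<close>)
      also have "\<dots> \<le> (2 * x * cmod (a - z))\<^sup>2 * (1 / (1 - (cmod z)\<^sup>2))"
        using r z by (intro mult_left_mono hardy_mean_kernel_le) auto
      also have "\<dots> = 4 * x * (x * (cmod (a - z))\<^sup>2 / (1 - (cmod z)\<^sup>2))"
        by (simp add: power_mult_distrib power2_eq_square)
      also have "\<dots> = 4 * x"
        using x ball_ne[OF z] by (simp add: x_def Re_cayley[OF norm_a])
      finally show ?thesis using x by (simp add: power_mult_distrib)
    qed
    have 3: "g0 w = 0" if "w \<notin> ball 0 1" for w using that by (simp add: g0_def)
    show ?thesis using H2_intro[OF 1 3 _ 2] x by simp
  qed
  define g where "g w = (if w \<in> ball 0 1 then p w ^ Suc m else 0)" for w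
  have "(\<lambda>w. p w ^ m) holomorphic_on ball 0 1" by (intro holomorphic_intros holp)
  moreover have "cmod (p w ^ m) \<le> 2 ^ m" if "w \<in> ball 0 1" for w
    using p2[OF that] by (simp add: norm_power power_mono)
  ultimately have "g \<in> H2 \<and> H2_norm g \<le> 2 ^ m * H2_norm g0"
    using H2_mult[of g0 "\<lambda>w. p w ^ m" "2 ^ m" g] g0 by (simp add: g_def g0_def)
  moreover have "2 ^ m * H2_norm g0 \<le> 2 ^ Suc m * sqrt x"
    using mult_left_mono[of "H2_norm g0" "2 * sqrt x" "2 ^ m"] g0 by (simp add: mult_ac)
  ultimately have "g \<in> H2" "H2_norm g \<le> 2 ^ Suc m * sqrt x" using order_trans by blast+
  then show ?thesis
    unfolding x_def by (intro bexI[of _ g]) (auto simp: g_def p_def x_def)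
qed

end

section \<open>A parabolic automorphism is a time of the flow\<close>

text \<open>
  If \<open>\<phi> \<alpha> = 0\<close>, then \<open>\<phi>\<close> composed with the inverse of the Moebius map at \<open>\<alpha>\<close> fixes 0, and so
  does its inverse. The Schwarz lemma for both makes this composition a rotation.
\<close>
lemma disk_automorphism_Moebius:
  assumes "disk_automorphism \<phi>"
  obtains c \<alpha> where "cmod c = 1" "cmod \<alpha> < 1"
    "\<And>z. z \<in> ball 0 1 \<Longrightarrow> \<phi> z = c * Moebius_function 0 \<alpha> z"
proof -
  have hol: "\<phi> holomorphic_on ball 0 1" and bij: "bij_betw \<phi> (ball 0 1) (ball 0 1)"
    using assms by (auto simp: disk_automorphism_def)
  have im: "\<phi> ` ball 0 1 = ball 0 1" and inj: "inj_on \<phi> (ball 0 1)"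
    using bij by (auto simp: bij_betw_def)
  obtain g where g: "g holomorphic_on ball 0 1" "\<And>z. z \<in> ball 0 1 \<Longrightarrow> g (\<phi> z) = z"
    using holomorphic_has_inverse[OF hol open_ball inj] im by metis
  have gb: "g z \<in> ball 0 1" if "z \<in> ball 0 1" for z using im g(2) that by (metis imageE)
  have \<phi>b: "\<phi> z \<in> ball 0 1" if "z \<in> ball 0 1" for z using im that by blast
  obtain \<alpha> where \<alpha>: "\<alpha> \<in> ball 0 1" "\<phi> \<alpha> = 0" using im by (metis centre_in_ball imageE zero_less_one)
  then have \<alpha>1: "norm \<alpha> < 1" by simp
  let ?M = "Moebius_function 0 \<alpha>" and ?N = "Moebius_function 0 (-\<alpha>)"
  have Mb: "?M z \<in> ball 0 1" and Nb: "?N z \<in> ball 0 1" if "z \<in> ball 0 1" for z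
    using that \<alpha>1 by (auto intro: Moebius_function_norm_lt_1)
  have MN: "?M (?N z) = z" and NM: "?N (?M z) = z" if "z \<in> ball 0 1" for z
    using that \<alpha>1 by (auto intro: Moebius_function_compose)
  define f where "f z = \<phi> (?N z)" for z
  define h where "h z = ?M (g z)" for z
  have f: "f holomorphic_on ball 0 1" "f 0 = 0" "\<And>z. norm z < 1 \<Longrightarrow> norm (f z) < 1"
    unfolding f_def
    using \<alpha> \<phi>b Nb
    by (auto intro!: holomorphic_on_compose_gen[unfolded o_def, OF Moebius_function_holomorphic hol]
        simp: Moebius_function_of_zero)
  have g0: "g 0 = \<alpha>" using g(2)[OF \<alpha>(1)] \<alpha>(2) by simp
  have h: "h holomorphic_on ball 0 1" "h 0 = 0" "\<And>z. norm z < 1 \<Longrightarrow> norm (h z) < 1"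
    unfolding h_def
    using \<alpha> gb Mb
    by (auto intro!: holomorphic_on_compose_gen[unfolded o_def, OF g(1) Moebius_function_holomorphic]
        simp: g0 Moebius_function_eq_zero)
  \<comment> \<open>Equality in the Schwarz lemma is needed at one nonzero point only.\<close>
  define z0 :: complex where "z0 = 1/2"
  have z0: "norm z0 < 1" "z0 \<noteq> 0" "z0 \<in> ball 0 1" by (auto simp: z0_def)
  have "h (f z0) = z0" using Nb[OF z0(3)] MN[OF z0(3)] by (simp add: h_def f_def g(2) del: mem_ball_0)
  then have "norm z0 \<le> norm (f z0)"
    using Schwarz_Lemma(1)[OF h(1,2,3) f(3)[OF z0(1)]] by simp
  moreover have "norm (f z0) \<le> norm z0" by (rule Schwarz_Lemma(1)[OF f z0(1)])
  ultimately have "norm (f z0) = norm z0" by simp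
  then obtain c where c: "\<forall>z. norm z < 1 \<longrightarrow> f z = c * z" "norm c = 1"
    using Schwarz_Lemma(3)[OF f z0(1)] z0 by blast
  have "\<phi> z = c * ?M z" if z: "z \<in> ball 0 1" for z
    using c(1) Mb[OF z] NM[OF z] unfolding f_def by (metis mem_ball_0)
  then show ?thesis using that c(2) \<alpha>1 by blast
qed

text \<open>
  In the half-plane an automorphism that fixes infinity is affine, \<open>w \<mapsto> p w + \<i> s\<close> with
  \<open>p > 0\<close> and \<open>s\<close> real. If \<open>p \<noteq> 1\<close>, it has a second boundary fixed point \<open>\<i> s / (1 - p)\<close>; if
  \<open>p = 1\<close> and \<open>s = 0\<close>, it is the identity.
\<close>
lemma (in boundary_point) parabolic_automorphism_is_flow:
  assumes par: "parabolic_automorphism \<phi>" and fixed: "disk_extension \<phi> a = a"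
  obtains \<tau> where "\<tau> \<noteq> 0" "\<And>z. z \<in> ball 0 1 \<Longrightarrow> \<phi> z = parabolic_flow a \<tau> z"
proof -
  obtain c \<alpha> where c: "cmod c = 1" and \<alpha>: "cmod \<alpha> < 1"
    and \<phi>: "\<And>z. z \<in> ball 0 1 \<Longrightarrow> \<phi> z = c * Moebius_function 0 \<alpha> z"
    using par disk_automorphism_Moebius unfolding parabolic_automorphism_def by metis
  have nofix: "\<phi> z \<noteq> z" if "z \<in> ball 0 1" for z
    using par that by (auto simp: parabolic_automorphism_def)
  have uniq: "w = a" if "cmod w = 1" "disk_extension \<phi> w = w" for w
    using par that fixed norm_a unfolding parabolic_automorphism_def by auto
  define m where "m z = c * (z - \<alpha>) / (1 - cnj \<alpha> * z)" for z
  have \<phi>m: "\<phi> z = m z" if "z \<in> ball 0 1" for z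
    using \<phi>[OF that] by (simp add: m_def Moebius_function_simple)
  have dnz: "1 - cnj \<alpha> * z \<noteq> 0" if "cmod z \<le> 1" for z
  proof -
    have "cmod (cnj \<alpha> * z) < 1"
      using \<alpha> that by (metis complex_mod_cnj mult_left_le norm_ge_zero norm_mult order_le_less_trans)
    then show ?thesis by (metis less_irrefl norm_one right_minus_eq)
  qed
  have ext: "disk_extension \<phi> w = m w" if w: "cmod w = 1" for w
  proof -
    have "isCont m w" unfolding m_def using dnz[of w] w by (intro continuous_intros) auto
    then have "(m \<longlongrightarrow> m w) (at w within ball 0 1)"
      unfolding isCont_def by (rule tendsto_within_subset) simp
    then have "(\<phi> \<longlongrightarrow> m w) (at w within ball 0 1)"
      by (rule Lim_transform_within[OF _ zero_less_one]) (simp add: \<phi>m)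
    moreover have "\<not> trivial_limit (at w within ball 0 1)"
      using w by (simp add: trivial_limit_within islimpt_ball)
    ultimately show ?thesis using w by (simp add: disk_extension_def tendsto_Lim)
  qed
  define k where "k = 1 - cnj \<alpha> * a"
  define N where "N = 1 - (cmod \<alpha>)\<^sup>2"
  have N: "N > 0" using \<alpha> by (simp add: N_def power_less_one_iff)
  have Nc: "complex_of_real N = 1 - \<alpha> * cnj \<alpha>"
    unfolding N_def of_real_diff complex_norm_square by simp
  have knz: "k \<noteq> 0" using dnz[of a] norm_a by (simp add: k_def)
  have cnz: "c \<noteq> 0" using c by auto
  have aa: "a * cnj a = 1" using norm_a by (simp add: complex_norm_square[symmetric])
  have ma: "m a = a" using ext[OF norm_a] fixed by simp
  have ck: "c * cnj k = k"
  proof -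
    have "c * (a - \<alpha>) = a * k" using ma knz by (simp add: m_def k_def field_simps)
    moreover have "a - \<alpha> = a * cnj k" using aa by (simp add: k_def algebra_simps)
    ultimately have "a * (c * cnj k) = a * k" by (simp add: mult_ac)
    then show ?thesis using a_nz by simp
  qed
  have am: "a - m z = c * (a - z) * of_real N / (k * (1 - cnj \<alpha> * z))" if z: "cmod z \<le> 1" for z
  proof -
    have "a - m z = m a - m z" using ma by simp
    also have "\<dots> = c * (a - z) * of_real N / (k * (1 - cnj \<alpha> * z))"
      using dnz[OF z] knz unfolding m_def k_def[symmetric]
      by (simp add: Nc divide_simps) (simp add: k_def algebra_simps)
    finally show ?thesis .
  qed
  have mne: "m z \<noteq> a" if "cmod z \<le> 1" "z \<noteq> a" for z
    using am[OF that(1)] that(2) dnz[OF that(1)] knz cnz N by auto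
  define p where "p = (cmod k)\<^sup>2 / N"
  define s where "s = 2 * Im (a * cnj \<alpha>) / N"
  have hm: "cayley a (m z) = of_real p * cayley a z + \<i> * of_real s" if z: "cmod z \<le> 1" "z \<noteq> a" for z
  proof -
    have kk: "k / c = cnj k" using ck cnz by (simp add: field_simps)
    have p: "of_real p * complex_of_real N = k * cnj k"
      using N unfolding p_def complex_norm_square[symmetric] by simp
    have q: "of_real p + 2 * a * cnj \<alpha> * cnj k / of_real N - 1 = \<i> * of_real s"
    proof -
      have "of_real N * (of_real p + 2 * a * cnj \<alpha> * cnj k / of_real N - 1) = k * cnj k + 2 * a * cnj \<alpha> * cnj k - of_real N"
        using N p by (simp add: algebra_simps)
      also have "\<dots> = a * cnj \<alpha> - cnj (a * cnj \<alpha>)"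
        using aa by (simp add: k_def Nc) (simp add: algebra_simps)
      also have "\<dots> = \<i> * of_real (2 * Im (a * cnj \<alpha>))" by (simp add: complex_eq_iff)
      also have "2 * Im (a * cnj \<alpha>) = N * s" using N by (simp add: s_def)
      also have "\<i> * of_real (N * s) = of_real N * (\<i> * of_real s)" by simp
      finally show ?thesis using N by simp
    qed
    have "1 + cayley a (m z) = 2 * a / (a - m z)" by (rule one_plus_cayley[OF mne[OF z]])
    also have "\<dots> = 2 * a * (k / c) * (k + cnj \<alpha> * (a - z)) / (of_real N * (a - z))"
      unfolding am[OF z(1)] using N by (simp add: k_def algebra_simps)
    also have "\<dots> = (k * cnj k) / of_real N * (2 * a / (a - z)) + 2 * a * cnj \<alpha> * cnj k / of_real N"
      using z(2) N unfolding kk by (simp add: divide_simps) (simp add: algebra_simps)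
    also have "\<dots> = of_real p * (1 + cayley a z) + 2 * a * cnj \<alpha> * cnj k / of_real N"
      using N unfolding one_plus_cayley[OF z(2)] p[symmetric] by simp
    finally have "cayley a (m z) =
        of_real p * (1 + cayley a z) + 2 * a * cnj \<alpha> * cnj k / of_real N - 1"
      by (metis add_diff_cancel_left')
    also have "\<dots> = of_real p * cayley a z + (of_real p + 2 * a * cnj \<alpha> * cnj k / of_real N - 1)"
      by (simp add: distrib_left)
    finally show ?thesis unfolding q .
  qed
  have p1: "p = 1"
  proof (rule ccontr)
    assume p: "p \<noteq> 1"
    define t where "t = s / (1 - p)"
    define w where "w = \<i> * of_real t"
    have w1: "w + 1 \<noteq> 0" by (simp add: w_def complex_eq_iff)
    define b where "b = a * (w - 1) / (w + 1)"
    have "cmod (w - 1) = cmod (w + 1)" by (simp add: w_def cmod_def)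
    then have b1: "cmod b = 1" using norm_a w1 by (simp add: b_def norm_divide norm_mult)
    have ab: "a - b = 2 * a / (w + 1)" "a + b = 2 * a * w / (w + 1)"
      using w1 by (simp_all add: b_def field_simps)
    then have ba: "b \<noteq> a" using w1 a_nz by auto
    have hb: "cayley a b = w" unfolding cayley_def ab using w1 a_nz by simp
    have "p * t + s = t" using p by (simp add: t_def field_simps)
    then have "cayley a (m b) = w"
      using hm[of b] b1 ba unfolding hb w_def
      by (metis (no_types, lifting) distrib_left mult.left_commute of_real_add of_real_mult order_refl)
    then have "m b = b"
      using b1 ba hb by (intro cayley_inj[OF a_nz mne]) auto
    then show False using uniq[OF b1] ext[OF b1] ba by simp
  qed
  have flow: "\<phi> z = parabolic_flow a s z" if z: "z \<in> ball 0 1" for z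
  proof (rule flow_eqI[OF z, symmetric])
    have "\<phi> ` ball 0 1 = ball 0 1"
      using par by (simp add: parabolic_automorphism_def disk_automorphism_def bij_betw_def)
    then show "\<phi> z \<in> ball 0 1" using z by blast
    show "cayley a (\<phi> z) = cayley a z + \<i> * of_real s"
      using hm[of z] z ball_ne[OF z] p1 \<phi>m[OF z] by simp
  qed
  moreover have "s \<noteq> 0" using flow[of 0] flow_zero[of 0] nofix[of 0] by auto
  ultimately show ?thesis using that by blast
qed

section \<open>Weighted compositions along the flow and their resolvent\<close>

lemma prod_le_exceptional:
  fixes x :: "nat \<Rightarrow> real"
  assumes A: "finite A" and x: "\<And>k. k \<in> A \<Longrightarrow> 0 \<le> x k" "\<And>k. k \<in> A \<Longrightarrow> x k \<le> \<rho> * E"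
    and E: "1 \<le> E" "0 \<le> \<rho>" and N: "card {k \<in> A. \<rho> < x k} \<le> N"
  shows "prod x A \<le> \<rho> ^ card A * E ^ N"
proof -
  have "prod x A \<le> (\<Prod>k\<in>A. \<rho> * (if \<rho> < x k then E else 1))"
    using x by (intro prod_mono) auto
  also have "\<dots> = \<rho> ^ card A * E ^ card {k \<in> A. \<rho> < x k}"
    using A by (simp add: prod.distrib prod.inter_filter[symmetric])
  also have "\<dots> \<le> \<rho> ^ card A * E ^ N"
    using E N by (intro mult_left_mono power_increasing) auto
  finally show ?thesis .
qed

lemma card_le_diameter:
  fixes A :: "nat set"
  assumes "finite A" and d: "\<And>i j. i \<in> A \<Longrightarrow> j \<in> A \<Longrightarrow> i \<le> j \<Longrightarrow> j - i < N"
  shows "card A \<le> N"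
proof (cases "A = {}")
  case False
  have "A \<subseteq> {Min A..<Min A + N}"
  proof
    fix j assume j: "j \<in> A"
    then have "Min A \<le> j" "Min A \<in> A" using assms(1) False by auto
    with d[of "Min A" j] j show "j \<in> {Min A..<Min A + N}" by auto
  qed
  then have "card A \<le> card {Min A..<Min A + N}" by (intro card_mono) auto
  then show ?thesis by simp
qed simp

lemma linear_times_geometric_bounded:
  fixes q :: real
  assumes "0 \<le> q" "q < 1"
  shows "\<exists>C>0. \<forall>n. (A + real n * b) * q ^ n \<le> C"
proof -
  have "(\<lambda>n. of_nat n * q ^ n) \<longlonglongrightarrow> 0" using assms by (intro powser_times_n_limit_0) simp
  moreover have "(\<lambda>n. q ^ n) \<longlonglongrightarrow> 0" using assms by (intro LIMSEQ_power_zero) simp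
  ultimately have "(\<lambda>n. A * q ^ n + b * (of_nat n * q ^ n)) \<longlonglongrightarrow> A * 0 + b * 0"
    by (intro tendsto_add tendsto_mult tendsto_const)
  then have "Bseq (\<lambda>n. A * q ^ n + b * (of_nat n * q ^ n))"
    by (intro convergent_imp_Bseq convergentI)
  then obtain C where "C > 0" "\<And>n. norm (A * q ^ n + b * (of_nat n * q ^ n)) \<le> C"
    by (auto elim: BseqE)
  then show ?thesis by (intro exI[of _ C]) (auto simp: algebra_simps abs_le_iff)
qed

lemma weighted_composition_bounded_operator:
  assumes "\<phi> holomorphic_on ball 0 1" "\<And>z. z \<in> ball 0 1 \<Longrightarrow> \<phi> z \<in> ball 0 1"
    and "u holomorphic_on ball 0 1" "\<And>z. z \<in> ball 0 1 \<Longrightarrow> cmod (u z) \<le> M"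
  shows "H2_bounded_operator (weighted_composition u \<phi>)"
  unfolding H2_bounded_operator_def
proof (intro conjI)
  show "\<forall>f\<in>H2. weighted_composition u \<phi> f \<in> H2"
    using H2_weighted_composition(1)[OF _ assms] by blast
  show "\<exists>K. \<forall>f\<in>H2. H2_norm (weighted_composition u \<phi> f) \<le> K * H2_norm f"
    using H2_weighted_composition(2)[OF _ assms] by blast
qed (auto simp: weighted_composition_def fun_eq_iff algebra_simps)

lemma bounded_operator_minus_scalar:
  assumes T: "H2_bounded_operator T"
  shows "H2_bounded_operator (\<lambda>f z. T f z - \<mu> * f z)"
proof -
  obtain K where K: "\<And>f. f \<in> H2 \<Longrightarrow> H2_norm (T f) \<le> K * H2_norm f"
    using T unfolding H2_bounded_operator_def by blast
  have in1: "T f \<in> H2" if "f \<in> H2" for f using T that by (auto simp: H2_bounded_operator_def)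
  have eq: "(\<lambda>z. T f z - \<mu> * f z) = (\<lambda>z. T f z + - \<mu> * f z)" for f by auto
  have 1: "(\<lambda>z. T f z - \<mu> * f z) \<in> H2" "H2_norm (\<lambda>z. T f z - \<mu> * f z) \<le> (2 * (K + cmod \<mu>)) * H2_norm f"
    if f: "f \<in> H2" for f
  proof -
    note s = H2_scale[OF f, of "-\<mu>"]
    show "(\<lambda>z. T f z - \<mu> * f z) \<in> H2" unfolding eq by (rule H2_add(1)[OF in1[OF f] s(1)])
    show "H2_norm (\<lambda>z. T f z - \<mu> * f z) \<le> (2 * (K + cmod \<mu>)) * H2_norm f"
      using H2_add(2)[OF in1[OF f] s(1)] s(2) K[OF f] unfolding eq by (simp add: algebra_simps)
  qed
  have 2: "T (\<lambda>z. f z + g z) z = T f z + T g z" if "f \<in> H2" "g \<in> H2" for f g z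
    using T that by (simp add: H2_bounded_operator_def)
  have 3: "T (\<lambda>z. c * f z) z = c * T f z" if "f \<in> H2" for f c z
    using T that by (simp add: H2_bounded_operator_def)
  show ?thesis
    unfolding H2_bounded_operator_def
  proof (intro conjI)
    show "\<exists>K. \<forall>f\<in>H2. H2_norm (\<lambda>z. T f z - \<mu> * f z) \<le> K * H2_norm f" using 1(2) by blast
  qed (use 1(1) in \<open>auto simp: fun_eq_iff algebra_simps 2 3\<close>)
qed

text \<open>
  A functional \<open>L\<close> that almost annihilates the range of \<open>T - \<nu>\<close> must be small if \<open>T - \<mu>\<close> has a
  bounded inverse \<open>S\<close> and \<open>\<nu>\<close> is close to \<open>\<mu>\<close>: writing \<open>g = (T - \<mu>) (S g)\<close> shows that every
  bound \<open>M\<close> for \<open>L\<close> improves to \<open>\<eta> K + M / 2\<close>. The limit of the iterated improvement is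
  \<open>2 \<eta> K\<close>. The room between \<open>\<mu>\<close> and \<open>\<nu>\<close> is what makes boundary points of a disk of approximate
  eigenvalues accessible.
\<close>
lemma approximate_adjoint_eigenvector:
  assumes inv: "H2_invertible (\<lambda>f z. T f z - \<mu> * f z)"
  obtains K where "0 < K"
    "\<And>L \<nu> M \<eta> g. \<lbrakk>\<And>f g. f \<in> H2 \<Longrightarrow> g \<in> H2 \<Longrightarrow> L (\<lambda>z. f z + g z) = L f + L g;
        \<And>c f. f \<in> H2 \<Longrightarrow> L (\<lambda>z. c * f z) = c * L f;
        \<And>f. f \<in> H2 \<Longrightarrow> cmod (L f) \<le> M * H2_norm f;
        \<And>f. f \<in> H2 \<Longrightarrow> cmod (L (\<lambda>z. T f z - \<nu> * f z)) \<le> \<eta> * H2_norm f;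
        0 \<le> M; 0 \<le> \<eta>; cmod (\<mu> - \<nu>) * K \<le> 1/2; g \<in> H2\<rbrakk> \<Longrightarrow> cmod (L g) \<le> 2 * \<eta> * K * H2_norm g"
proof -
  obtain S K0 where S: "H2_bounded_operator S" "\<And>g. g \<in> H2 \<Longrightarrow> (\<lambda>z. T (S g) z - \<mu> * S g z) = g"
    and K0: "\<And>g. g \<in> H2 \<Longrightarrow> H2_norm (S g) \<le> K0 * H2_norm g"
  proof -
    from inv obtain S where S: "H2_bounded_operator S"
      "\<forall>g\<in>H2. S (\<lambda>z. T g z - \<mu> * g z) = g \<and> (\<lambda>z. T (S g) z - \<mu> * S g z) = g"
      unfolding H2_invertible_def by blast
    moreover from S(1) obtain K0 where "\<forall>g\<in>H2. H2_norm (S g) \<le> K0 * H2_norm g"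
      unfolding H2_bounded_operator_def by blast
    ultimately show ?thesis using that by blast
  qed
  define K where "K = max 1 K0"
  have K: "K > 0" by (simp add: K_def)
  have SK: "S g \<in> H2" "H2_norm (S g) \<le> K * H2_norm g" if g: "g \<in> H2" for g
  proof -
    show "S g \<in> H2" using S(1) g by (auto simp: H2_bounded_operator_def)
    have "K0 * H2_norm g \<le> K * H2_norm g"
      using H2_norm_nonneg[OF g] by (intro mult_right_mono) (auto simp: K_def)
    then show "H2_norm (S g) \<le> K * H2_norm g" using K0[OF g] by linarith
  qed
  show ?thesis
  proof (rule that[OF K])
    fix L :: "(complex \<Rightarrow> complex) \<Rightarrow> complex" and \<nu> :: complex and M \<eta> :: real and g
    assume add: "\<And>f g. f \<in> H2 \<Longrightarrow> g \<in> H2 \<Longrightarrow> L (\<lambda>z. f z + g z) = L f + L g"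
      and scale: "\<And>c f. f \<in> H2 \<Longrightarrow> L (\<lambda>z. c * f z) = c * L f"
      and M: "\<And>f. f \<in> H2 \<Longrightarrow> cmod (L f) \<le> M * H2_norm f" "0 \<le> M"
      and \<eta>: "\<And>f. f \<in> H2 \<Longrightarrow> cmod (L (\<lambda>z. T f z - \<nu> * f z)) \<le> \<eta> * H2_norm f" "0 \<le> \<eta>"
      and small: "cmod (\<mu> - \<nu>) * K \<le> 1/2" and g: "g \<in> H2"
    have step: "cmod (L g) \<le> (\<eta> * K + M' / 2) * H2_norm g"
      if M': "\<And>f. f \<in> H2 \<Longrightarrow> cmod (L f) \<le> M' * H2_norm f" "0 \<le> M'" and g: "g \<in> H2" for M' g
    proof -
      note f = SK[OF g]
      have ng: "0 \<le> H2_norm g" by (rule H2_norm_nonneg[OF g])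
      have "(\<lambda>z. T (S g) z - \<nu> * S g z) = (\<lambda>z. g z + (\<mu> - \<nu>) * S g z)"
        using fun_cong[OF S(2)[OF g]] by (auto simp: fun_eq_iff algebra_simps)
      then have "L g = L (\<lambda>z. T (S g) z - \<nu> * S g z) - (\<mu> - \<nu>) * L (S g)"
        by (simp add: add[OF g H2_scale(1)[OF f(1)]] scale[OF f(1)])
      then have "cmod (L g) \<le> cmod (L (\<lambda>z. T (S g) z - \<nu> * S g z)) + cmod (\<mu> - \<nu>) * cmod (L (S g))"
        by (metis norm_mult norm_triangle_ineq4)
      also have "\<dots> \<le> \<eta> * H2_norm (S g) + cmod (\<mu> - \<nu>) * (M' * H2_norm (S g))"
        by (intro add_mono mult_left_mono \<eta> M' f) auto
      also have "\<dots> \<le> \<eta> * (K * H2_norm g) + cmod (\<mu> - \<nu>) * (M' * (K * H2_norm g))"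
        by (intro add_mono mult_left_mono \<eta> M' f) auto
      also have "\<dots> = \<eta> * K * H2_norm g + (cmod (\<mu> - \<nu>) * K) * (M' * H2_norm g)" by simp
      also have "\<dots> \<le> \<eta> * K * H2_norm g + 1/2 * (M' * H2_norm g)"
        using small M' ng by (intro add_left_mono mult_right_mono) auto
      finally show ?thesis by (simp add: algebra_simps)
    qed
    have iter: "cmod (L g) \<le> (M / 2 ^ n + 2 * \<eta> * K) * H2_norm g" if "g \<in> H2" for g n
      using that
    proof (induction n arbitrary: g)
      case 0
      have "M * H2_norm g \<le> (M + 2 * \<eta> * K) * H2_norm g"
        using H2_norm_nonneg[OF 0] \<eta> K by (intro mult_right_mono) auto
      then show ?case using M(1)[OF 0] by simp
    next
      case (Suc n)
      have "cmod (L g) \<le> (\<eta> * K + (M / 2 ^ n + 2 * \<eta> * K) / 2) * H2_norm g"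
        by (rule step[OF Suc.IH _ Suc.prems]) (use M \<eta> K in auto)
      then show ?case by (simp add: field_simps)
    qed
    have "(\<lambda>n. (M * (1/2) ^ n + 2 * \<eta> * K) * H2_norm g) \<longlonglongrightarrow> (M * 0 + 2 * \<eta> * K) * H2_norm g"
      by (intro tendsto_intros LIMSEQ_power_zero) auto
    then have "cmod (L g) \<le> (M * 0 + 2 * \<eta> * K) * H2_norm g"
      by (rule LIMSEQ_le_const) (use iter[OF g] in \<open>auto simp: power_one_over\<close>)
    then show "cmod (L g) \<le> 2 * \<eta> * K * H2_norm g" by simp
  qed
qed

locale parabolic_weight = boundary_point +
  fixes \<tau> :: real and \<psi> :: "complex \<Rightarrow> complex" and l :: complex and M :: real
  assumes \<tau>: "\<tau> \<noteq> 0" and hol: "\<psi> holomorphic_on ball 0 1"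
    and bounded: "\<And>z. z \<in> ball 0 1 \<Longrightarrow> cmod (\<psi> z) \<le> M"
    and lim: "(\<psi> \<longlongrightarrow> l) (at a within ball 0 1)"
begin

abbreviation flow :: "real \<Rightarrow> complex \<Rightarrow> complex" where "flow \<equiv> parabolic_flow a"
abbreviation T where "T \<equiv> weighted_composition \<psi> (flow \<tau>)"

lemma T_bounded_operator: "H2_bounded_operator T"
  by (rule weighted_composition_bounded_operator[OF flow_holomorphic flow_in_ball hol bounded])

text \<open>
  The weight of the \<open>n\<close>-th power of the operator.
\<close>
definition cocycle :: "nat \<Rightarrow> complex \<Rightarrow> complex" where
  "cocycle n z = (\<Prod>k<n. \<psi> (flow (real k * \<tau>) z))"

lemma hol_flow: "(\<lambda>z. \<psi> (flow t z)) holomorphic_on ball 0 1"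
  by (rule holomorphic_on_compose_gen[unfolded o_def, OF flow_holomorphic hol]) (auto simp del: mem_ball_0 intro: flow_in_ball)

lemma cocycle_holomorphic: "cocycle n holomorphic_on ball 0 1"
  unfolding cocycle_def by (intro holomorphic_intros hol_flow)

lemma cocycle_Suc: "cocycle (Suc n) z = cocycle n z * \<psi> (flow (real n * \<tau>) z)"
  by (simp add: cocycle_def)

lemma cocycle_Suc_shift:
  assumes z: "z \<in> ball 0 1"
  shows "cocycle (Suc n) z = \<psi> z * cocycle n (flow \<tau> z)"
proof -
  have "flow (real (Suc k) * \<tau>) z = flow (real k * \<tau>) (flow \<tau> z)" for k
    by (simp add: flow_flow[OF z] algebra_simps)
  then show ?thesis
    unfolding cocycle_def by (subst prod.lessThan_Suc_shift) (simp add: flow_zero[OF z] del: of_nat_Suc)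
qed

text \<open>
  Along a flow line only boundedly many steps, uniformly in the starting point, stay in the
  region \<open>\<bar>cayley a z\<bar> < R\<close>, where the weight may exceed \<open>\<rho>\<close>.
\<close>
lemma cocycle_bound:
  assumes \<rho>: "cmod l < \<rho>"
  shows "\<exists>B>0. \<forall>n. \<forall>z\<in>ball 0 1. cmod (cocycle n z) \<le> B * \<rho> ^ n"
proof -
  obtain R where R: "R > 0" "\<And>z. z \<in> ball 0 1 \<Longrightarrow> R \<le> cmod (cayley a z) \<Longrightarrow> cmod (\<psi> z - l) < \<rho> - cmod l"
    using tendsto_boundary_cayley[OF lim, of "\<rho> - cmod l"] \<rho> by auto
  have \<rho>0: "\<rho> > 0" using \<rho> norm_ge_zero[of l] by linarith
  have far: "cmod (\<psi> z) \<le> \<rho>" if "z \<in> ball 0 1" "R \<le> cmod (cayley a z)" for z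
    using R(2)[OF that] norm_triangle_ineq2[of "\<psi> z" l] by linarith
  define E where "E = max 1 (M / \<rho>)"
  have E: "1 \<le> E" "M \<le> \<rho> * E" using \<rho>0 by (auto simp: E_def field_simps max_def)
  define N where "N = Suc (nat \<lfloor>2 * R / \<bar>\<tau>\<bar>\<rfloor>)"
  have "cmod (cocycle n z) \<le> E ^ N * \<rho> ^ n" if z: "z \<in> ball 0 1" for n z
  proof -
    let ?x = "\<lambda>k. cmod (\<psi> (flow (real k * \<tau>) z))"
    have near: "cmod (cayley a z + \<i> * of_real (real k * \<tau>)) < R" if "\<rho> < ?x k" for k
      using far[OF flow_in_ball[OF z], of "real k * \<tau>"] that cayley_flow[OF z, of "real k * \<tau>"] by fastforce
    have "card {k \<in> {..<n}. \<rho> < ?x k} \<le> N"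
    proof (rule card_le_diameter)
      fix i j assume ij: "i \<in> {k \<in> {..<n}. \<rho> < ?x k}" "j \<in> {k \<in> {..<n}. \<rho> < ?x k}" "i \<le> j"
      have "cmod ((cayley a z + \<i> * of_real (real j * \<tau>)) - (cayley a z + \<i> * of_real (real i * \<tau>))) < R + R"
        using ij near[of i] near[of j]
          norm_triangle_ineq4[of "cayley a z + \<i> * of_real (real j * \<tau>)" "cayley a z + \<i> * of_real (real i * \<tau>)"]
        by auto
      also have "(cayley a z + \<i> * of_real (real j * \<tau>)) - (cayley a z + \<i> * of_real (real i * \<tau>)) =
          \<i> * of_real (real (j - i) * \<tau>)"
        using ij(3) by (simp add: of_nat_diff algebra_simps)
      finally have "real (j - i) * \<bar>\<tau>\<bar> < 2 * R" by (simp add: norm_mult abs_mult del: of_real_mult)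
      then have "real (j - i) < 2 * R / \<bar>\<tau>\<bar>" using \<tau> by (simp add: field_simps)
      then show "j - i < N" unfolding N_def by linarith
    qed simp
    then have "prod ?x {..<n} \<le> \<rho> ^ card {..<n} * E ^ N"
      using bounded[OF flow_in_ball[OF z]] E \<rho>0
      by (intro prod_le_exceptional) (auto intro: order_trans)
    then show ?thesis by (simp add: cocycle_def prod_norm mult.commute)
  qed
  moreover have "E ^ N > 0" using E by simp
  ultimately show ?thesis by blast
qed

text \<open>
  The terms \<open>T ^ n f / \<mu> ^ (n + 1)\<close> of the Neumann series.
\<close>
definition resolvent_term :: "complex \<Rightarrow> nat \<Rightarrow> (complex \<Rightarrow> complex) \<Rightarrow> complex \<Rightarrow> complex" where
  "resolvent_term \<mu> n = weighted_composition (\<lambda>z. cocycle n z / \<mu> ^ Suc n) (flow (real n * \<tau>))"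

lemma resolvent_term_bound:
  assumes \<mu>: "cmod l < cmod \<mu>"
  shows "\<exists>C>0. \<exists>q. 0 < q \<and> q < 1 \<and> (\<forall>n. \<forall>f\<in>H2. resolvent_term \<mu> n f \<in> H2 \<and>
    H2_norm (resolvent_term \<mu> n f) \<le> C * H2_norm f * q ^ n)"
proof -
  obtain \<rho> where \<rho>: "cmod l < \<rho>" "\<rho> < cmod \<mu>" using dense[OF \<mu>] by blast
  have \<rho>0: "\<rho> > 0" using \<rho> norm_ge_zero[of l] by linarith
  have \<mu>0: "cmod \<mu> > 0" using \<rho> \<rho>0 by linarith
  obtain B where B: "B > 0" "\<And>n z. z \<in> ball 0 1 \<Longrightarrow> cmod (cocycle n z) \<le> B * \<rho> ^ n"
    using cocycle_bound[OF \<rho>(1)] by blast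
  \<comment> \<open>One factor \<open>q ^ n\<close> absorbs the linear growth of the composition norms, the other one remains.\<close>
  define q where "q = sqrt (\<rho> / cmod \<mu>)"
  have q: "0 < q" "q < 1" using \<rho> \<rho>0 \<mu>0 by (simp_all add: q_def)
  have qq: "\<rho> = q * q * cmod \<mu>" using \<rho>0 \<mu>0 by (simp add: q_def)
  obtain C where C: "C > 0" "\<And>n. (2 + real n * \<bar>\<tau>\<bar>) * q ^ n \<le> C"
    using linear_times_geometric_bounded[of q 2 "\<bar>\<tau>\<bar>"] q by auto
  have main: "resolvent_term \<mu> n f \<in> H2 \<and> H2_norm (resolvent_term \<mu> n f) \<le> (B / cmod \<mu> * C) * H2_norm f * q ^ n"
    if f: "f \<in> H2" for n f
  proof -
    let ?M = "B / cmod \<mu> * (q ^ n * q ^ n)"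
    have h: "(\<lambda>z. cocycle n z / \<mu> ^ Suc n) holomorphic_on ball 0 1"
      using \<mu>0 by (intro holomorphic_intros cocycle_holomorphic) auto
    have b: "cmod (cocycle n z / \<mu> ^ Suc n) \<le> ?M" if "z \<in> ball 0 1" for z
    proof -
      have "cmod (cocycle n z) / cmod \<mu> ^ Suc n \<le> B * \<rho> ^ n / cmod \<mu> ^ Suc n"
        using B(2)[OF that] by (intro divide_right_mono) auto
      also have "\<dots> = ?M" using \<mu>0 unfolding qq by (simp add: power_mult_distrib)
      finally show ?thesis by (simp add: norm_divide norm_power norm_mult)
    qed
    note wc = H2_weighted_composition[OF f flow_holomorphic flow_in_ball h b, of "real n * \<tau>"]
    have c0: "cayley a 0 = 1" using a_nz by (simp add: cayley_def)
    have "2 / sqrt (1 - (cmod (flow (real n * \<tau>) 0))\<^sup>2) \<le> 2 + real n * \<bar>\<tau>\<bar>"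
      using flow_factor[of 0 "real n * \<tau>"] by (simp add: c0 abs_mult)
    then have "?M * (2 / sqrt (1 - (cmod (flow (real n * \<tau>) 0))\<^sup>2)) * H2_norm f
        \<le> ?M * (2 + real n * \<bar>\<tau>\<bar>) * H2_norm f"
      using B \<mu>0 q H2_norm_nonneg[OF f] by (intro mult_right_mono mult_left_mono) auto
    also have "\<dots> = (B / cmod \<mu>) * q ^ n * H2_norm f * ((2 + real n * \<bar>\<tau>\<bar>) * q ^ n)" by simp
    also have "\<dots> \<le> (B / cmod \<mu>) * q ^ n * H2_norm f * C"
      using B \<mu>0 q H2_norm_nonneg[OF f] by (intro mult_left_mono C) auto
    finally show ?thesis using wc unfolding resolvent_term_def by (simp add: mult_ac)
  qed
  show ?thesis
    using main B C q \<mu>0 by (intro exI[of _ "B / cmod \<mu> * C"] conjI exI[of _ q]) auto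
qed

text \<open>
  The Neumann series converges by \<open>resolvent_term_bound\<close>. That its sum inverts \<open>T - \<mu>\<close> on both
  sides is checked pointwise, where both identities telescope.
\<close>
lemma resolvent_invertible:
  assumes \<mu>: "cmod l < cmod \<mu>"
  shows "H2_invertible (\<lambda>f z. T f z - \<mu> * f z)"
proof -
  obtain C q where C: "C > 0" and q: "0 < q" "q < 1"
    and u: "\<And>n f. f \<in> H2 \<Longrightarrow> resolvent_term \<mu> n f \<in> H2"
      "\<And>n f. f \<in> H2 \<Longrightarrow> H2_norm (resolvent_term \<mu> n f) \<le> C * H2_norm f * q ^ n"
    using resolvent_term_bound[OF \<mu>] by blast
  have \<mu>0: "\<mu> \<noteq> 0" using \<mu> by auto
  let ?u = "resolvent_term \<mu>"
  define S where "S f = (\<lambda>z. - (\<Sum>n. ?u n f z))" for f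
  have Cf: "0 \<le> C * H2_norm f" if "f \<in> H2" for f using C H2_norm_nonneg[OF that] by simp
  have summ: "summable (\<lambda>n. ?u n f z)" if "f \<in> H2" for f z
    by (rule H2_series(1)[OF u(1)[OF that] u(2)[OF that] q Cf[OF that]])
  have S1: "S f \<in> H2" "H2_norm (S f) \<le> C / (1 - q) * H2_norm f" if f: "f \<in> H2" for f
  proof -
    note s = H2_series(2,3)[OF u(1)[OF f] u(2)[OF f] q Cf[OF f]]
    have eq: "S f = (\<lambda>z. (-1) * (\<Sum>n. ?u n f z))" by (simp add: S_def)
    show "S f \<in> H2" unfolding eq by (rule H2_scale(1)[OF s(1)])
    show "H2_norm (S f) \<le> C / (1 - q) * H2_norm f"
      using H2_scale(2)[OF s(1), of "-1"] s(2) unfolding eq by simp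
  qed
  have u_add: "?u n (\<lambda>z. f z + g z) z = ?u n f z + ?u n g z" for n f g z
    by (simp add: resolvent_term_def weighted_composition_def distrib_left add_divide_distrib)
  have u_scale: "?u n (\<lambda>z. c * f z) z = c * ?u n f z" for n c f z
    by (simp add: resolvent_term_def weighted_composition_def)
  have S_op: "H2_bounded_operator S"
    unfolding H2_bounded_operator_def
  proof (intro conjI)
    show "\<forall>f\<in>H2. \<forall>g\<in>H2. S (\<lambda>z. f z + g z) = (\<lambda>z. S f z + S g z)"
      by (auto simp: S_def u_add fun_eq_iff suminf_add[OF summ summ, symmetric])
    show "\<forall>c. \<forall>f\<in>H2. S (\<lambda>z. c * f z) = (\<lambda>z. c * S f z)"
      by (auto simp: S_def u_scale fun_eq_iff suminf_mult[OF summ])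
    show "\<exists>K. \<forall>f\<in>H2. H2_norm (S f) \<le> K * H2_norm f" using S1 by blast
  qed (use S1 in blast)
  have u0: "?u 0 f z = f z / \<mu>" if "z \<in> ball 0 1" for f z
    using that by (simp add: resolvent_term_def weighted_composition_def cocycle_def flow_zero del: mem_ball_0)
  have uT: "?u n (T f) z = \<mu> * ?u (Suc n) f z" if z: "z \<in> ball 0 1" for n f z
  proof -
    have e: "flow \<tau> (flow (real n * \<tau>) z) = flow (real (Suc n) * \<tau>) z"
      by (simp add: flow_flow[OF z] algebra_simps)
    show ?thesis
      using z \<mu>0 flow_in_ball[OF z, of "real n * \<tau>"]
      by (simp add: resolvent_term_def weighted_composition_def cocycle_Suc e del: mem_ball_0 of_nat_Suc)
  qed
  have Tu: "\<psi> z * ?u n f (flow \<tau> z) = \<mu> * ?u (Suc n) f z" if z: "z \<in> ball 0 1" for n f z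
  proof -
    have e: "flow (real n * \<tau>) (flow \<tau> z) = flow (real (Suc n) * \<tau>) z"
      by (simp add: flow_flow[OF z] algebra_simps)
    show ?thesis
      using z \<mu>0 flow_in_ball[OF z, of \<tau>]
      by (simp add: resolvent_term_def weighted_composition_def cocycle_Suc_shift[OF z] e del: mem_ball_0 of_nat_Suc)
  qed
  have tele: "(\<lambda>n. \<mu> * ?u (Suc n) f z - \<mu> * ?u n f z) sums (- f z)"
    if f: "f \<in> H2" and z: "z \<in> ball 0 1" for f z
  proof -
    have "(\<lambda>n. \<mu> * ?u n f z) \<longlonglongrightarrow> \<mu> * 0"
      by (intro tendsto_intros summable_LIMSEQ_zero summ f)
    from telescope_sums[OF this] show ?thesis using u0[OF z, of f] \<mu>0 by simp
  qed
  have inv1: "S (\<lambda>z. T f z - \<mu> * f z) = f" if f: "f \<in> H2" for f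
  proof
    fix z show "S (\<lambda>z. T f z - \<mu> * f z) z = f z"
    proof (cases "z \<in> ball 0 1")
      case True
      have "?u n (\<lambda>z. T f z - \<mu> * f z) z = \<mu> * ?u (Suc n) f z - \<mu> * ?u n f z" for n
        using u_add[of n "T f" "\<lambda>z. - \<mu> * f z" z] u_scale[of n "-\<mu>" f z] uT[OF True, of n f] by simp
      then show ?thesis using sums_unique[OF tele[OF f True], symmetric] by (simp add: S_def)
    next
      case False
      then show ?thesis using H2_outside[OF f False]
        by (simp add: S_def resolvent_term_def weighted_composition_def)
    qed
  qed
  have inv2: "(\<lambda>z. T (S f) z - \<mu> * S f z) = f" if f: "f \<in> H2" for f
  proof
    fix z show "T (S f) z - \<mu> * S f z = f z"
    proof (cases "z \<in> ball 0 1")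
      case True
      have "T (S f) z = - (\<psi> z * (\<Sum>n. ?u n f (flow \<tau> z)))"
        using True by (simp add: weighted_composition_def S_def)
      also have "\<psi> z * (\<Sum>n. ?u n f (flow \<tau> z)) = (\<Sum>n. \<mu> * ?u (Suc n) f z)"
        by (simp add: suminf_mult[OF summ[OF f], symmetric] Tu[OF True])
      finally have "T (S f) z - \<mu> * S f z = - ((\<Sum>n. \<mu> * ?u (Suc n) f z) - (\<Sum>n. \<mu> * ?u n f z))"
        by (simp add: S_def suminf_mult[OF summ[OF f]])
      also have "\<dots> = - (\<Sum>n. \<mu> * ?u (Suc n) f z - \<mu> * ?u n f z)"
        using summ[OF f, of z] summable_Suc_iff[of "\<lambda>n. ?u n f z"]
        by (subst suminf_diff) (auto intro!: summable_mult)
      also have "\<dots> = f z" using sums_unique[OF tele[OF f True], symmetric] by simp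
      finally show ?thesis .
    next
      case False
      then show ?thesis using H2_outside[OF f False] H2_outside[OF S1(1)[OF f] False]
        by (simp add: weighted_composition_def)
    qed
  qed
  show ?thesis
    unfolding H2_invertible_def
    using bounded_operator_minus_scalar[OF T_bounded_operator] S_op inv1 inv2 by blast
qed

lemma invertible_of_bounded_below:
  assumes \<delta>: "0 < \<delta>" "\<And>z. z \<in> ball 0 1 \<Longrightarrow> \<delta> \<le> cmod (\<psi> z)"
  shows "H2_invertible T"
proof -
  have nz: "\<psi> z \<noteq> 0" if "z \<in> ball 0 1" for z using \<delta>(2)[OF that] \<delta>(1) by auto
  define S where "S = weighted_composition (\<lambda>z. 1 / \<psi> (flow (-\<tau>) z)) (flow (-\<tau>))"
  have "H2_bounded_operator S"
    unfolding S_def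
  proof (rule weighted_composition_bounded_operator[OF flow_holomorphic flow_in_ball])
    show "(\<lambda>z. 1 / \<psi> (flow (-\<tau>) z)) holomorphic_on ball 0 1"
      using nz flow_in_ball by (intro holomorphic_intros hol_flow) blast
    show "cmod (1 / \<psi> (flow (-\<tau>) z)) \<le> 1 / \<delta>" if "z \<in> ball 0 1" for z
      using \<delta>(1) \<delta>(2)[OF flow_in_ball[OF that, of "-\<tau>"]] by (simp add: norm_divide frac_le)
  qed
  moreover have "S (T f) = f" "T (S f) = f" if f: "f \<in> H2" for f
  proof -
    have e: "flow \<tau> (flow (-\<tau>) z) = z" "flow (-\<tau>) (flow \<tau> z) = z" if "z \<in> ball 0 1" for z
      using flow_flow[OF that] flow_zero[OF that] by simp_all
    show "S (T f) = f" "T (S f) = f"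
      using nz flow_in_ball H2_outside[OF f]
      by (auto simp: S_def weighted_composition_def fun_eq_iff e simp del: mem_ball_0)
  qed
  ultimately show ?thesis using T_bounded_operator unfolding H2_invertible_def by blast
qed

section \<open>Approximate eigenvectors of the adjoint\<close>

text \<open>
  The weight is close to 0 at some points \<open>z\<close> with \<open>\<bar>cayley a z\<bar> < R\<close>, but it may be just as
  small further back on their flow lines. Take the largest number \<open>n0\<close> of backward steps after
  which values close to 0 still occur; it exists, because all these flow lines have left the
  region after \<open>N\<close> steps. The points reached after \<open>n0\<close> steps then have backward orbits on
  which the weight is at least some \<open>\<delta> > 0\<close>.
\<close>
lemma backward_orbit_selection:
  assumes \<rho>: "0 < \<rho>" and R: "\<And>z. z \<in> ball 0 1 \<Longrightarrow> R \<le> cmod (cayley a z) \<Longrightarrow> \<rho> \<le> cmod (\<psi> z)"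
    and small: "\<And>\<epsilon>. 0 < \<epsilon> \<Longrightarrow> \<exists>z\<in>ball 0 1. cmod (\<psi> z) < \<epsilon>"
  obtains D \<delta> N where "0 < \<delta>" "\<delta> \<le> \<rho>"
    "\<And>\<epsilon>. 0 < \<epsilon> \<Longrightarrow> \<exists>z\<in>ball 0 1. cmod (\<psi> z) < \<epsilon> \<and> cmod (cayley a z) \<le> D \<and>
       (\<forall>n\<ge>1. \<delta> \<le> cmod (\<psi> (flow (- real n * \<tau>) z))) \<and>
       (\<forall>n\<ge>N. \<rho> \<le> cmod (\<psi> (flow (- real n * \<tau>) z)))"
proof -
  define W where "W = {z \<in> ball 0 1. cmod (cayley a z) < R}"
  define A where "A n \<longleftrightarrow> (\<forall>\<epsilon>>0. \<exists>z\<in>W. cmod (\<psi> (flow (- real n * \<tau>) z)) < \<epsilon>)" for n :: nat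
  have A0: "A 0"
    unfolding A_def
  proof (intro allI impI)
    fix \<epsilon> :: real assume "0 < \<epsilon>"
    then obtain z where z: "z \<in> ball 0 1" "cmod (\<psi> z) < min \<epsilon> \<rho>" using small[of "min \<epsilon> \<rho>"] \<rho> by auto
    then have "z \<in> W" using R[OF z(1)] by (force simp: W_def)
    then show "\<exists>z\<in>W. cmod (\<psi> (flow (- real 0 * \<tau>) z)) < \<epsilon>"
      using z flow_zero[OF z(1)] by (intro bexI[of _ z]) auto
  qed
  define N where "N = nat \<lceil>2 * R / \<bar>\<tau>\<bar>\<rceil>"
  have far: "\<rho> \<le> cmod (\<psi> (flow (- real n * \<tau>) z))" if "n \<ge> N" "z \<in> W" for n z
  proof (rule R)
    show "flow (- real n * \<tau>) z \<in> ball 0 1" using that by (intro flow_in_ball) (simp add: W_def)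
    have "2 * R / \<bar>\<tau>\<bar> \<le> real n" using that(1) unfolding N_def by linarith
    then have "2 * R \<le> real n * \<bar>\<tau>\<bar>" using \<tau> by (simp add: field_simps)
    then show "R \<le> cmod (cayley a (flow (- real n * \<tau>) z))"
      using norm_cayley_flow_ge[of z "- real n * \<tau>"] that(2) by (auto simp: W_def abs_mult)
  qed
  have "n < N" if "A n" for n
    using that far[of n] \<rho> unfolding A_def by (meson not_le)
  then obtain n0 where n0: "A n0" "\<And>n. A n \<Longrightarrow> n \<le> n0"
    using A0 by (metis (no_types, lifting) GreatestI_nat Greatest_le_nat less_imp_le)
  have "\<exists>d>0. \<forall>z\<in>W. d \<le> cmod (\<psi> (flow (- real n * \<tau>) z))" if "n > n0" for n
  proof -
    have "\<not> A n" using n0(2)[of n] that by auto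
    then show ?thesis unfolding A_def by (meson not_le)
  qed
  then obtain d where d: "\<And>n. n > n0 \<Longrightarrow> d n > 0"
    "\<And>n z. n > n0 \<Longrightarrow> z \<in> W \<Longrightarrow> d n \<le> cmod (\<psi> (flow (- real n * \<tau>) z))"
    by metis
  \<comment> \<open>Beyond \<open>N\<close> steps the bound is \<open>\<rho>\<close>; including \<open>\<rho>\<close> also keeps the set nonempty.\<close>
  define \<delta> where "\<delta> = Min (insert \<rho> (d ` {n0<..<N}))"
  have \<delta>: "0 < \<delta>" "\<delta> \<le> \<rho>" using \<rho> d(1) by (auto simp: \<delta>_def)
  have near: "\<delta> \<le> cmod (\<psi> (flow (- real n * \<tau>) z))" if "n > n0" "z \<in> W" for n z
  proof (cases "n < N")
    case True
    then have "\<delta> \<le> d n" using that by (auto simp: \<delta>_def intro!: Min_le)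
    then show ?thesis using d(2)[OF that] by linarith
  next
    case False
    then show ?thesis using far[of n z] that \<delta> by auto
  qed
  show ?thesis
  proof (rule that[OF \<delta>, of "R + real n0 * \<bar>\<tau>\<bar>" N])
    fix \<epsilon> :: real assume "0 < \<epsilon>"
    then obtain y where y: "y \<in> W" "cmod (\<psi> (flow (- real n0 * \<tau>) y)) < \<epsilon>"
      using n0(1) unfolding A_def by blast
    have yb: "y \<in> ball 0 1" "cmod (cayley a y) < R" using y(1) by (auto simp: W_def)
    define z where "z = flow (- real n0 * \<tau>) y"
    have zn: "flow (- real n * \<tau>) z = flow (- real (n0 + n) * \<tau>) y" for n
      by (simp add: z_def flow_flow[OF yb(1)] algebra_simps)
    have "z \<in> ball 0 1" unfolding z_def by (rule flow_in_ball[OF yb(1)])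
    moreover have "cmod (cayley a z) \<le> R + real n0 * \<bar>\<tau>\<bar>"
      using norm_cayley_flow_le[OF yb(1), of "- real n0 * \<tau>"] yb(2) by (simp add: z_def abs_mult)
    moreover have "\<delta> \<le> cmod (\<psi> (flow (- real n * \<tau>) z))" if "n \<ge> 1" for n
      unfolding zn using that y(1) by (intro near) auto
    moreover have "\<rho> \<le> cmod (\<psi> (flow (- real n * \<tau>) z))" if "n \<ge> N" for n
      unfolding zn using that y(1) by (intro far) auto
    ultimately show "\<exists>z\<in>ball 0 1. cmod (\<psi> z) < \<epsilon> \<and> cmod (cayley a z) \<le> R + real n0 * \<bar>\<tau>\<bar> \<and>
       (\<forall>n\<ge>1. \<delta> \<le> cmod (\<psi> (flow (- real n * \<tau>) z))) \<and>
       (\<forall>n\<ge>N. \<rho> \<le> cmod (\<psi> (flow (- real n * \<tau>) z)))"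
      using y(2) unfolding z_def by (intro bexI[of _ "flow (- real n0 * \<tau>) y"]) auto
  qed
qed

text \<open>
  The coefficients that solve \<open>c (n + 1) \<psi> (w (n + 1)) = \<nu> c n\<close> along the backward orbit
  \<open>w n = flow (- n \<tau>) z\<close>, with \<open>c 0 = 1\<close>.
\<close>
definition adjoint_coeff :: "complex \<Rightarrow> complex \<Rightarrow> nat \<Rightarrow> complex" where
  "adjoint_coeff \<nu> z n = (\<Prod>k<n. \<nu> / \<psi> (flow (- real (Suc k) * \<tau>) z))"

definition adjoint_functional :: "complex \<Rightarrow> complex \<Rightarrow> (complex \<Rightarrow> complex) \<Rightarrow> complex" where
  "adjoint_functional \<nu> z f = (\<Sum>n. adjoint_coeff \<nu> z n * f (flow (- real n * \<tau>) z))"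

lemma adjoint_coeff_bound:
  assumes \<rho>: "0 < \<delta>" "\<delta> \<le> \<rho>" and q: "0 < q" "cmod \<nu> \<le> q * \<rho>"
    and \<delta>: "\<And>n. 1 \<le> n \<Longrightarrow> \<delta> \<le> cmod (\<psi> (flow (- real n * \<tau>) z))"
    and far: "\<And>n. N \<le> n \<Longrightarrow> \<rho> \<le> cmod (\<psi> (flow (- real n * \<tau>) z))"
  shows "cmod (adjoint_coeff \<nu> z n) \<le> (\<rho> / \<delta>) ^ N * q ^ n"
proof -
  let ?x = "\<lambda>k. cmod (\<nu> / \<psi> (flow (- real (Suc k) * \<tau>) z))"
  have "{k \<in> {..<n}. q < ?x k} \<subseteq> {..<N}"
  proof
    fix k assume k: "k \<in> {k \<in> {..<n}. q < ?x k}"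
    show "k \<in> {..<N}"
    proof (rule ccontr)
      assume "k \<notin> {..<N}"
      then have f: "\<rho> \<le> cmod (\<psi> (flow (- real (Suc k) * \<tau>) z))" by (intro far) auto
      have "?x k \<le> q * \<rho> / \<rho>"
        unfolding norm_divide using f \<rho> q by (intro frac_le) auto
      then show False using k \<rho> by auto
    qed
  qed
  then have "card {k \<in> {..<n}. q < ?x k} \<le> card {..<N}" by (intro card_mono) auto
  then have "prod ?x {..<n} \<le> q ^ card {..<n} * (\<rho> / \<delta>) ^ N"
  proof (intro prod_le_exceptional)
    fix k
    have "?x k \<le> q * \<rho> / \<delta>"
      unfolding norm_divide using \<delta>[of "Suc k"] \<rho> q by (intro frac_le) auto
    then show "?x k \<le> q * (\<rho> / \<delta>)" by simp
  qed (use \<rho> q in auto)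
  then show ?thesis by (simp add: adjoint_coeff_def prod_norm mult.commute)
qed

text \<open>
  The functional is a combination of the point evaluations along the backward orbit \<open>w n\<close>, and
  \<open>T\<close> turns the evaluation at \<open>w (n + 1)\<close> into \<open>\<psi> (w (n + 1))\<close> times the evaluation at \<open>w n\<close>.
  By the choice of the coefficients everything cancels in the last claim except for the step
  from \<open>w 0 = z\<close> to \<open>flow \<tau> z\<close>; if \<open>\<psi> z = 0\<close>, this is an eigenvector.
\<close>
lemma adjoint_functional_properties:
  assumes z: "z \<in> ball 0 1" and nz: "\<forall>n\<ge>1. \<psi> (flow (- real n * \<tau>) z) \<noteq> 0"
    and c: "\<And>n. cmod (adjoint_coeff \<nu> z n) \<le> C * q ^ n" and q: "0 < q" "q < 1" and C: "0 \<le> C"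
  shows "\<And>f g. f \<in> H2 \<Longrightarrow> g \<in> H2 \<Longrightarrow>
      adjoint_functional \<nu> z (\<lambda>z. f z + g z) = adjoint_functional \<nu> z f + adjoint_functional \<nu> z g" (is "PROP ?add")
    and "\<And>k f. f \<in> H2 \<Longrightarrow> adjoint_functional \<nu> z (\<lambda>z. k * f z) = k * adjoint_functional \<nu> z f" (is "PROP ?scale")
    and "\<exists>B\<ge>0. \<forall>f\<in>H2. cmod (adjoint_functional \<nu> z f) \<le> B * H2_norm f" (is ?bdd)
    and "\<And>f. f \<in> H2 \<Longrightarrow> adjoint_functional \<nu> z (\<lambda>w. T f w - \<nu> * f w) = \<psi> z * f (flow \<tau> z)" (is "PROP ?eig")
proof -
  let ?w = "\<lambda>n::nat. flow (- real n * \<tau>) z" and ?c = "adjoint_coeff \<nu> z"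
  \<comment> \<open>Half of the decay absorbs the linear growth of the point evaluations along the orbit.\<close>
  define r where "r = sqrt q"
  have r: "0 < r" "r < 1" "q = r * r" using q by (auto simp: r_def)
  have wb: "?w n \<in> ball 0 1" for n by (rule flow_in_ball[OF z])
  obtain E where E: "E > 0" "\<And>n. ((1 + cmod (cayley a z)) + real n * \<bar>\<tau>\<bar>) * r ^ n \<le> E"
    using linear_times_geometric_bounded[of r "1 + cmod (cayley a z)" "\<bar>\<tau>\<bar>"] r by auto
  define y where "y = sqrt (Re (cayley a z))"
  have y: "y > 0" using Re_cayley_pos[OF z] by (simp add: y_def)
  have term_le: "cmod (?c n * f (?w n)) \<le> (C * E / y * H2_norm f) * r ^ n" if f: "f \<in> H2" for f n
  proof -
    have nf: "0 \<le> H2_norm f" by (rule H2_norm_nonneg[OF f])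
    have "cmod (f (?w n)) \<le> 2 / sqrt (1 - (cmod (?w n))\<^sup>2) * H2_norm f"
      using wb[of n] by (intro H2_eval_le f) simp
    also have "\<dots> \<le> ((1 + cmod (cayley a z) + real n * \<bar>\<tau>\<bar>) / y) * H2_norm f"
      using flow_factor[OF z, of "- real n * \<tau>"] nf by (intro mult_right_mono) (auto simp: y_def abs_mult)
    finally have "cmod (?c n * f (?w n)) \<le> (C * q ^ n) * (((1 + cmod (cayley a z) + real n * \<bar>\<tau>\<bar>) / y) * H2_norm f)"
      unfolding norm_mult using c[of n] C q by (intro mult_mono) auto
    also have "\<dots> = C / y * H2_norm f * r ^ n * ((1 + cmod (cayley a z) + real n * \<bar>\<tau>\<bar>) * r ^ n)"
      unfolding r(3) by (simp add: power_mult_distrib)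
    also have "\<dots> \<le> C / y * H2_norm f * r ^ n * E"
      using C y nf r by (intro mult_left_mono E) auto
    finally show ?thesis by (simp add: mult_ac)
  qed
  have geo: "summable (\<lambda>n. k * r ^ n)" for k
    using r by (intro summable_mult summable_geometric) auto
  have summ: "summable (\<lambda>n. ?c n * f (?w n))" if "f \<in> H2" for f
    by (rule summable_comparison_test'[OF geo]) (rule term_le[OF that])
  show "PROP ?add"
    unfolding adjoint_functional_def distrib_left by (rule suminf_add[OF summ summ, symmetric])
  show "PROP ?scale"
    unfolding adjoint_functional_def
    by (subst mult.left_commute) (rule suminf_mult[OF summ])
  show ?bdd
  proof (intro exI[of _ "C * E / y / (1 - r)"] conjI ballI)
    show "0 \<le> C * E / y / (1 - r)" using C E y r by simp
    fix f assume f: "f \<in> H2"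
    have "cmod (adjoint_functional \<nu> z f) \<le> (\<Sum>n. (C * E / y * H2_norm f) * r ^ n)"
      unfolding adjoint_functional_def by (rule norm_suminf_le[OF term_le[OF f] geo])
    also have "\<dots> = C * E / y / (1 - r) * H2_norm f"
      using r by (subst suminf_mult) (auto simp: suminf_geometric summable_geometric)
    finally show "cmod (adjoint_functional \<nu> z f) \<le> C * E / y / (1 - r) * H2_norm f" .
  qed
  show "PROP ?eig"
  proof -
    fix f assume f: "f \<in> H2"
    define b where "b n = \<nu> * (?c n * f (?w n))" for n
    define t where "t n = ?c n * (T f (?w n) - \<nu> * f (?w n))" for n
    have w0: "?w 0 = z" using flow_zero[OF z] by simp
    have c0: "?c 0 = 1" by (simp add: adjoint_coeff_def)
    have t0: "t 0 = \<psi> z * f (flow \<tau> z) - b 0"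
      using z by (simp only: t_def b_def w0 c0) (simp add: weighted_composition_def)
    have tS: "t (Suc n) = b n - b (Suc n)" for n
    proof -
      have w: "flow \<tau> (?w (Suc n)) = ?w n" by (simp add: flow_flow[OF z] algebra_simps)
      have "?c (Suc n) * \<psi> (?w (Suc n)) = ?c n * \<nu>"
        using spec[OF nz, of "Suc n"] by (simp add: adjoint_coeff_def)
      then have "?c (Suc n) * (\<psi> (?w (Suc n)) * f (?w n)) = \<nu> * (?c n * f (?w n))"
        by (metis mult.assoc mult.commute)
      moreover have "T f (?w (Suc n)) = \<psi> (?w (Suc n)) * f (?w n)"
        unfolding weighted_composition_def w using wb[of "Suc n"] by simp
      ultimately show ?thesis by (simp add: t_def b_def right_diff_distrib mult.left_commute)
    qed
    have "b \<longlonglongrightarrow> \<nu> * 0" unfolding b_def by (intro tendsto_intros summable_LIMSEQ_zero summ f)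
    then have "(\<lambda>n. b n - b (Suc n)) sums (b 0 - 0)"
      by (intro telescope_sums') simp
    then have "(\<lambda>n. t (Suc n)) sums b 0" by (simp add: tS)
    then have "t sums (b 0 + t 0)" by (simp add: sums_Suc_iff)
    then show "adjoint_functional \<nu> z (\<lambda>w. T f w - \<nu> * f w) = \<psi> z * f (flow \<tau> z)"
      using sums_unique[of t] t0 unfolding adjoint_functional_def t_def by simp
  qed
qed

text \<open>
  The left side is the base of the peak function, evaluated \<open>n\<close> steps back on the flow line of
  its peak.
\<close>
lemma peak_decay:
  assumes x: "0 < x" "x \<le> D" and n: "1 \<le> n"
  shows "cmod (2 * of_real x / (2 * of_real x - \<i> * of_real (real n * \<tau>))) \<le> 2 * D / sqrt (4 * D\<^sup>2 + \<tau>\<^sup>2)"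
proof -
  have D: "D > 0" using x by simp
  have den: "cmod (2 * of_real x - \<i> * of_real (real n * \<tau>)) = sqrt (4 * x\<^sup>2 + (real n * \<tau>)\<^sup>2)"
    by (simp add: cmod_def power_mult_distrib)
  have "\<tau>\<^sup>2 \<le> (real n * \<tau>)\<^sup>2"
    using n by (simp add: power_mult_distrib mult_le_cancel_right1)
  then have "x\<^sup>2 * \<tau>\<^sup>2 \<le> D\<^sup>2 * (real n * \<tau>)\<^sup>2" using x by (intro mult_mono power_mono[of x D]) auto
  then have "x\<^sup>2 * (4 * D\<^sup>2 + \<tau>\<^sup>2) \<le> D\<^sup>2 * (4 * x\<^sup>2 + (real n * \<tau>)\<^sup>2)" by (simp add: algebra_simps)
  then have "sqrt (x\<^sup>2 * (4 * D\<^sup>2 + \<tau>\<^sup>2)) \<le> sqrt (D\<^sup>2 * (4 * x\<^sup>2 + (real n * \<tau>)\<^sup>2))"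
    by (rule real_sqrt_le_mono)
  then have "x * sqrt (4 * D\<^sup>2 + \<tau>\<^sup>2) \<le> D * sqrt (4 * x\<^sup>2 + (real n * \<tau>)\<^sup>2)"
    using x D by (simp add: real_sqrt_mult)
  moreover have "0 < sqrt (4 * D\<^sup>2 + \<tau>\<^sup>2)" "0 < sqrt (4 * x\<^sup>2 + (real n * \<tau>)\<^sup>2)"
    using x D by (auto intro!: add_pos_nonneg)
  ultimately have "2 * x / sqrt (4 * x\<^sup>2 + (real n * \<tau>)\<^sup>2) \<le> 2 * D / sqrt (4 * D\<^sup>2 + \<tau>\<^sup>2)"
    by (simp add: field_simps)
  then show ?thesis unfolding norm_divide den using x by (simp add: norm_mult)
qed

text \<open>
  With \<open>\<nu>\<close> in the open disk near \<open>\<mu>\<close>, the functional at a point \<open>z\<close> with small \<open>\<psi> z\<close> is an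
  approximate eigenvector of the adjoint with defect of order
  \<open>\<bar>\<psi> z\<bar> / sqrt (Re (cayley a z))\<close>. On a high power of the peak function at \<open>z\<close> it is at least
  1/2, while that function has norm of order \<open>sqrt (Re (cayley a z))\<close>. The two factors cancel,
  so that the argument covers zeros of \<open>\<psi>\<close> in the disk and values tending to 0 at the boundary
  alike.
\<close>
lemma disk_subset_spectrum:
  assumes l: "l \<noteq> 0" and small: "\<And>\<epsilon>. 0 < \<epsilon> \<Longrightarrow> \<exists>z\<in>ball 0 1. cmod (\<psi> z) < \<epsilon>"
    and \<mu>: "cmod \<mu> \<le> cmod l"
  shows "\<not> H2_invertible (\<lambda>f z. T f z - \<mu> * f z)"
proof
  assume "H2_invertible (\<lambda>f z. T f z - \<mu> * f z)"
  then obtain K where K: "0 < K"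
    and bound: "\<And>L \<nu> M \<eta> g. \<lbrakk>\<And>f g. f \<in> H2 \<Longrightarrow> g \<in> H2 \<Longrightarrow> L (\<lambda>z. f z + g z) = L f + L g;
        \<And>c f. f \<in> H2 \<Longrightarrow> L (\<lambda>z. c * f z) = c * L f;
        \<And>f. f \<in> H2 \<Longrightarrow> cmod (L f) \<le> M * H2_norm f;
        \<And>f. f \<in> H2 \<Longrightarrow> cmod (L (\<lambda>z. T f z - \<nu> * f z)) \<le> \<eta> * H2_norm f;
        0 \<le> M; 0 \<le> \<eta>; cmod (\<mu> - \<nu>) * K \<le> 1/2; g \<in> H2\<rbrakk> \<Longrightarrow> cmod (L g) \<le> 2 * \<eta> * K * H2_norm g"
    by (erule approximate_adjoint_eigenvector)
  \<comment> \<open>The coefficients of the functional decay only for parameters in the open disk, hence the detour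
    through \<open>\<nu>\<close> when \<open>\<bar>\<mu>\<bar> = \<bar>l\<bar>\<close>.\<close>
  define s where "s = min (1/2) (1 / (2 * K * cmod l))"
  have s: "0 < s" "s \<le> 1/2" "s * cmod l * K \<le> 1/2"
  proof -
    show "0 < s" "s \<le> 1/2" using K l by (auto simp: s_def)
    have "s * (2 * K * cmod l) \<le> 1 / (2 * K * cmod l) * (2 * K * cmod l)"
      using K by (intro mult_right_mono) (auto simp: s_def)
    then show "s * cmod l * K \<le> 1/2" using K l by (simp add: mult_ac)
  qed
  define \<nu> where "\<nu> = of_real (1 - s) * \<mu>"
  have "cmod \<nu> = (1 - s) * cmod \<mu>" using s by (simp add: \<nu>_def norm_mult del: of_real_diff)
  also have "\<dots> \<le> (1 - s) * cmod l" using s \<mu> by (intro mult_left_mono) auto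
  also have "\<dots> < cmod l" using s l by (simp add: algebra_simps)
  finally have \<nu>: "cmod \<nu> < cmod l" .
  have "\<mu> - \<nu> = of_real s * \<mu>" by (simp add: \<nu>_def algebra_simps)
  then have "cmod (\<mu> - \<nu>) * K = s * cmod \<mu> * K" using s by (simp add: norm_mult)
  also have "\<dots> \<le> s * cmod l * K" using s \<mu> K by (intro mult_right_mono mult_left_mono) auto
  finally have close: "cmod (\<mu> - \<nu>) * K \<le> 1/2" using s(3) by linarith
  obtain \<rho> where \<rho>: "cmod \<nu> < \<rho>" "\<rho> < cmod l" using dense[OF \<nu>] by blast
  have \<rho>0: "0 < \<rho>" using \<rho>(1) norm_ge_zero[of \<nu>] by linarith
  have "0 < cmod l - \<rho>" using \<rho> by simp
  then obtain R where R: "\<And>z. z \<in> ball 0 1 \<Longrightarrow> R \<le> cmod (cayley a z) \<Longrightarrow> cmod (\<psi> z - l) < cmod l - \<rho>"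
    using tendsto_boundary_cayley[OF lim] by blast
  have far: "\<rho> \<le> cmod (\<psi> z)" if "z \<in> ball 0 1" "R \<le> cmod (cayley a z)" for z
    using R[OF that] norm_triangle_ineq2[of l "\<psi> z"] norm_minus_commute[of l "\<psi> z"] by linarith
  obtain D0 \<delta> N where \<delta>: "0 < \<delta>" "\<delta> \<le> \<rho>"
    and sel: "\<And>\<epsilon>. 0 < \<epsilon> \<Longrightarrow> \<exists>z\<in>ball 0 1. cmod (\<psi> z) < \<epsilon> \<and> cmod (cayley a z) \<le> D0 \<and>
       (\<forall>n\<ge>1. \<delta> \<le> cmod (\<psi> (flow (- real n * \<tau>) z))) \<and>
       (\<forall>n\<ge>N. \<rho> \<le> cmod (\<psi> (flow (- real n * \<tau>) z)))"
    by (rule backward_orbit_selection[OF \<rho>0 far small that])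
  define D where "D = max 1 D0"
  have D: "D > 0" "D0 \<le> D" by (auto simp: D_def)
  obtain q where q: "cmod \<nu> / \<rho> < q" "q < 1" using dense[of "cmod \<nu> / \<rho>" 1] \<rho> \<rho>0 by auto
  have q0: "0 < q" using q(1) \<rho>0 by (smt (verit) divide_nonneg_pos norm_ge_zero)
  have \<nu>q: "cmod \<nu> \<le> q * \<rho>" using q(1) \<rho>0 by (simp add: field_simps)
  define C where "C = (\<rho> / \<delta>) ^ N"
  have C: "C > 0" using \<delta> \<rho>0 by (simp add: C_def)
  define \<kappa> where "\<kappa> = 2 * D / sqrt (4 * D\<^sup>2 + \<tau>\<^sup>2)"
  have \<kappa>: "0 < \<kappa>" "\<kappa> < 1"
  proof -
    have "2 * D = sqrt (4 * D\<^sup>2)" using D by (simp add: real_sqrt_mult)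
    also have "\<dots> < sqrt (4 * D\<^sup>2 + \<tau>\<^sup>2)" using \<tau> by simp
    finally have "2 * D < sqrt (4 * D\<^sup>2 + \<tau>\<^sup>2)" .
    moreover from this have "0 < sqrt (4 * D\<^sup>2 + \<tau>\<^sup>2)" using D by linarith
    ultimately show "0 < \<kappa>" "\<kappa> < 1" unfolding \<kappa>_def using D by (simp_all only: divide_pos_pos divide_less_eq_1_pos mult_pos_pos zero_less_numeral)
  qed
  \<comment> \<open>The power depends only on constants that are uniform in \<open>z\<close>, so \<open>z\<close> can be chosen after it.\<close>
  obtain m where m: "\<kappa> ^ m < (1 - q) / (2 * C)"
    using real_arch_pow_inv[of "(1 - q) / (2 * C)" \<kappa>] \<kappa> C q by auto
  define Q where "Q = K * (1 + D + \<bar>\<tau>\<bar>) * 2 ^ Suc m"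
  have Q: "Q > 0" using K D by (simp add: Q_def add_pos_nonneg)
  obtain z where z: "z \<in> ball 0 1" "cmod (\<psi> z) < 1 / (8 * Q)" "cmod (cayley a z) \<le> D0"
    "\<And>n. n \<ge> 1 \<Longrightarrow> \<delta> \<le> cmod (\<psi> (flow (- real n * \<tau>) z))"
    "\<And>n. n \<ge> N \<Longrightarrow> \<rho> \<le> cmod (\<psi> (flow (- real n * \<tau>) z))"
    using sel[of "1 / (8 * Q)"] Q by auto
  let ?c = "adjoint_coeff \<nu> z" and ?L = "adjoint_functional \<nu> z"
  define x where "x = Re (cayley a z)"
  have x: "0 < x" "x \<le> D"
    using Re_cayley_pos[OF z(1)] complex_Re_le_cmod[of "cayley a z"] z(3) D by (auto simp: x_def)
  have cb: "cmod (?c n) \<le> C * q ^ n" for n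
    unfolding C_def by (rule adjoint_coeff_bound[OF \<delta> q0 \<nu>q z(4) z(5)])
  have nz: "\<forall>n\<ge>1. \<psi> (flow (- real n * \<tau>) z) \<noteq> 0"
    using z(4) \<delta>(1) by fastforce
  note L = adjoint_functional_properties[OF z(1) nz cb q0 q(2) less_imp_le[OF C]]
  obtain B where B: "0 \<le> B" "\<And>f. f \<in> H2 \<Longrightarrow> cmod (?L f) \<le> B * H2_norm f" using L(3) by blast
  define \<eta> where "\<eta> = cmod (\<psi> z) * ((1 + D + \<bar>\<tau>\<bar>) / sqrt x)"
  have \<eta>0: "0 \<le> \<eta>" using D x by (simp add: \<eta>_def)
  have eig: "cmod (?L (\<lambda>w. T f w - \<nu> * f w)) \<le> \<eta> * H2_norm f" if f: "f \<in> H2" for f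
  proof -
    have "cmod (f (flow \<tau> z)) \<le> 2 / sqrt (1 - (cmod (flow \<tau> z))\<^sup>2) * H2_norm f"
      using flow_in_ball[OF z(1), of \<tau>] by (intro H2_eval_le f) simp
    also have "\<dots> \<le> ((1 + D + \<bar>\<tau>\<bar>) / sqrt x) * H2_norm f"
    proof (intro mult_right_mono H2_norm_nonneg f)
      have "(1 + cmod (cayley a z) + \<bar>\<tau>\<bar>) / sqrt x \<le> (1 + D + \<bar>\<tau>\<bar>) / sqrt x"
        using z(3) D x by (intro divide_right_mono) auto
      then show "2 / sqrt (1 - (cmod (flow \<tau> z))\<^sup>2) \<le> (1 + D + \<bar>\<tau>\<bar>) / sqrt x"
        using flow_factor[OF z(1), of \<tau>] unfolding x_def by linarith
    qed
    finally show ?thesis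
      unfolding L(4)[OF f] norm_mult \<eta>_def mult.assoc by (intro mult_left_mono) auto
  qed
  obtain g where g: "g \<in> H2" "H2_norm g \<le> 2 ^ Suc m * sqrt x"
    and gv: "\<And>w. w \<in> ball 0 1 \<Longrightarrow> g w = (2 * of_real x / (cayley a w + cnj (cayley a z))) ^ Suc m"
    using H2_peak_function[OF z(1), of m] unfolding x_def by blast
  have gw: "g (flow (- real n * \<tau>) z) = (2 * of_real x / (2 * of_real x - \<i> * of_real (real n * \<tau>))) ^ Suc m" for n
  proof -
    have "cayley a z + cnj (cayley a z) = 2 * of_real x" by (simp add: x_def complex_add_cnj)
    then have "cayley a (flow (- real n * \<tau>) z) + cnj (cayley a z) = 2 * of_real x - \<i> * of_real (real n * \<tau>)"
      unfolding cayley_flow[OF z(1)] by (simp add: algebra_simps)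
    then show ?thesis by (simp only: gv[OF flow_in_ball[OF z(1)]])
  qed
  define t where "t n = ?c n * g (flow (- real n * \<tau>) z)" for n
  have t0: "t 0 = 1" unfolding t_def gw using x by (simp add: adjoint_coeff_def)
  have tn: "cmod (t (Suc n)) \<le> \<kappa> ^ m * C * q ^ n" for n
  proof -
    have "cmod (g (flow (- real (Suc n) * \<tau>) z)) \<le> \<kappa> ^ Suc m"
      unfolding gw norm_power \<kappa>_def using x by (intro power_mono peak_decay) auto
    then have "cmod (t (Suc n)) \<le> (C * q ^ Suc n) * \<kappa> ^ Suc m"
      unfolding t_def norm_mult using C q0 by (intro mult_mono cb) auto
    also have "\<dots> = \<kappa> ^ m * C * q ^ n * (q * \<kappa>)" by simp
    also have "\<dots> \<le> \<kappa> ^ m * C * q ^ n * 1"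
      using \<kappa> C q q0 by (intro mult_left_mono mult_le_one) auto
    finally show ?thesis by simp
  qed
  have geo: "summable (\<lambda>n. \<kappa> ^ m * C * q ^ n)"
    using q q0 by (intro summable_mult summable_geometric) auto
  have tsum: "summable (\<lambda>n. t (Suc n))"
    by (rule summable_comparison_test'[OF geo]) (rule tn)
  have "cmod (\<Sum>n. t (Suc n)) \<le> (\<Sum>n. \<kappa> ^ m * C * q ^ n)"
    by (rule norm_suminf_le[OF tn geo])
  also have "\<dots> = \<kappa> ^ m * C / (1 - q)"
    using q q0 by (subst suminf_mult) (auto simp: suminf_geometric summable_geometric)
  also have "\<dots> \<le> 1/2" using m C q by (simp add: field_simps)
  finally have "cmod (\<Sum>n. t (Suc n)) \<le> 1/2" .
  moreover have "?L g = (\<Sum>n. t (Suc n)) + 1"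
    using suminf_split_head[of t] tsum t0 unfolding adjoint_functional_def t_def[symmetric]
    by (simp add: summable_Suc_iff)
  ultimately have "1/2 \<le> cmod (?L g)"
    using norm_diff_ineq[of 1 "\<Sum>n. t (Suc n)"] by (simp add: add.commute)
  also have "\<dots> \<le> 2 * \<eta> * K * H2_norm g"
    by (rule bound[OF L(1,2) B(2) eig B(1) \<eta>0 close g(1)])
  also have "\<dots> \<le> 2 * \<eta> * K * (2 ^ Suc m * sqrt x)"
    using \<eta>0 K by (intro mult_left_mono g) auto
  also have "\<dots> = 2 * (cmod (\<psi> z) * Q)"
    using x by (simp add: \<eta>_def Q_def)
  also have "cmod (\<psi> z) * Q < 1/8" using z(2) Q by (simp add: field_simps)
  finally show False by simp
qed

end

theorem theorem3p2p5:
  fixes \<phi> \<psi> :: "complex \<Rightarrow> complex" and a \<psi>a :: complex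
  assumes "parabolic_automorphism \<phi>"
    and "a \<in> sphere 0 1"
    and "denjoy_wolff_point \<phi> a"
    and "\<psi> \<in> Hinf"
    and "\<exists>z\<in>ball 0 1. \<psi> z \<noteq> 0"
    and "(\<psi> \<longlongrightarrow> \<psi>a) (at a within ball 0 1)"
    and "\<not> H2_invertible (weighted_composition \<psi> \<phi>)"
  shows "H2_spectrum (weighted_composition \<psi> \<phi>) = {\<mu>. cmod \<mu> \<le> cmod \<psi>a}"
proof -
  interpret boundary_point a using assms(2) by unfold_locales simp
  obtain \<tau> where t: "\<tau> \<noteq> 0" "\<And>z. z \<in> ball 0 1 \<Longrightarrow> \<phi> z = parabolic_flow a \<tau> z"
    using parabolic_automorphism_is_flow[OF assms(1)] assms(3) by (auto simp: denjoy_wolff_point_def)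
  obtain M where M: "\<And>z. z \<in> ball 0 1 \<Longrightarrow> cmod (\<psi> z) \<le> M"
    using assms(4) unfolding Hinf_def bounded_iff by blast
  interpret parabolic_weight a \<tau> \<psi> \<psi>a M
    using t M assms(4,6) by unfold_locales (auto simp: Hinf_def)
  have T: "weighted_composition \<psi> \<phi> = T"
    using t(2) by (auto simp: weighted_composition_def fun_eq_iff)
  have small: "\<exists>z\<in>ball 0 1. cmod (\<psi> z) < \<epsilon>" if "0 < \<epsilon>" for \<epsilon>
    using invertible_of_bounded_below[OF that] assms(7) unfolding T by (meson not_le)
  have "\<not> H2_invertible (\<lambda>f z. T f z - \<mu> * f z) \<longleftrightarrow> cmod \<mu> \<le> cmod \<psi>a" for \<mu>
  proof (cases "\<psi>a = 0")
    case True
    then show ?thesis using resolvent_invertible[of \<mu>] assms(7) unfolding T by (cases "\<mu> = 0") auto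
  next
    case False
    then show ?thesis using resolvent_invertible[of \<mu>] disk_subset_spectrum[OF False small, of \<mu>]
      by (meson not_le)
  qed
  then show ?thesis unfolding H2_spectrum_def T by blast
qed

end
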